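(* There exist rational functions $\tilde A_h(q)$ and $\tilde B_h(q)$ in $q$ (for integers $h\ge1$) such that $$\tilde a_h(q)=(-q;q)_\infty\,\tilde A_h(q)\quad(h\ge1),$$ $$\tilde b_{2h}(q)=(-q;q)_\infty\,\tilde B_{2h}(q)\quad(h\ge1),$$ $$\tilde b_{2h+1}(q)=(-q;q)_\infty\Bigl(\tilde B_{2h+1}(q)+\sum_{k=1}^\infty\frac{q^k}{1+q^k}\Bigr)\quad(h\ge0).$$
   Context: A partition $\lambda=(\lambda_1\ge\lambda_2\ge\dots\ge\lambda_\ell>0)$ of $n$ is drawn as its Ferrers diagram: left-adjusted rows of boxes, with $\lambda_i$ boxes in row $i$. The hook number of the box in row $i$ and column $j$ is the number of boxes in the L-shape consisting of that box, all boxes to its right in the same row, and all boxes below it in the same column. $\mathcal H(\lambda)$ denotes the multiset of all hook numbers of $\lambda$. Let $\mathcal O(n)$ be the set of partitions of $n$ all of whose parts are odd and $\mathcal D(n)$ the set of partitions of $n$ whose parts are pairwise distinct. For integers $h\ge1$ and $n\ge0$, define $$a_h(n)=\sum_{\lambda\in\mathcal O(n)}\#\{x\in\mathcal H(\lambda):x=h\},\qquad b_h(n)=\sum_{\lambda\in\mathcal D(n)}\#\{x\in\mathcal H(\lambda):x=h\},$$ counted with multiplicity, and set $\tilde a_h(q)=\sum_{n\ge0}a_h(n)q^n$, $\tilde b_h(q)=\sum_{n\ge0}b_h(n)q^n$. Also $(-q;q)_\infty=\prod_{j\ge1}(1+q^j)$. *)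

theory Defs
  imports
    "HOL-Analysis.Infinite_Products"
    "HOL-Library.Multiset"
    "HOL-Computational_Algebra.Computational_Algebra"
    "HOL-Computational_Algebra.Field_as_Ring"
begin

definition partitions :: "nat \<Rightarrow> nat list set" where
  "partitions n = {p. sorted_wrt (\<ge>) p \<and> (\<forall>x\<in>set p. 0 < x) \<and> sum_list p = n}"

definition odd_partitions :: "nat \<Rightarrow> nat list set" where
  "odd_partitions n = {p \<in> partitions n. \<forall>x\<in>set p. odd x}"

definition distinct_partitions :: "nat \<Rightarrow> nat list set" where
  "distinct_partitions n = {p \<in> partitions n. distinct p}"

text \<open>Boxes are pairs (row, column), both numbered from 0.\<close>

definition ferrers :: "nat list \<Rightarrow> (nat \<times> nat) set" where
  "ferrers p = {(i, j). i < length p \<and> j < p ! i}"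

definition hook :: "nat list \<Rightarrow> nat \<times> nat \<Rightarrow> (nat \<times> nat) set" where
  "hook p = (\<lambda>(i, j). {(i', j') \<in> ferrers p. (i' = i \<and> j' \<ge> j) \<or> (j' = j \<and> i' \<ge> i)})"

definition hook_numbers :: "nat list \<Rightarrow> nat multiset" where
  "hook_numbers p = image_mset (\<lambda>x. card (hook p x)) (mset_set (ferrers p))"

definition hooks_odd :: "nat \<Rightarrow> nat \<Rightarrow> nat" where
  "hooks_odd h n = (\<Sum>p\<in>odd_partitions n. count (hook_numbers p) h)"

definition hooks_distinct :: "nat \<Rightarrow> nat \<Rightarrow> nat" where
  "hooks_distinct h n = (\<Sum>p\<in>distinct_partitions n. count (hook_numbers p) h)"

definition a_gf :: "nat \<Rightarrow> rat fps" where
  "a_gf h = Abs_fps (\<lambda>n. of_nat (hooks_odd h n))"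

definition b_gf :: "nat \<Rightarrow> rat fps" where
  "b_gf h = Abs_fps (\<lambda>n. of_nat (hooks_distinct h n))"

text \<open>
  The infinite product and sum below are limits in the metric topology of formal power series;
  the index is shifted so that it starts at 0.
\<close>

definition qpoch_neg :: "rat fps" where
  "qpoch_neg = (\<Prod>j. 1 + fps_X ^ Suc j)"

definition lambert_sum :: "rat fps" where
  "lambert_sum = (\<Sum>k. fps_X ^ Suc k / (1 + fps_X ^ Suc k))"

text \<open>
  Rational functions are elements of the fraction field of the polynomial ring.  They may have a
  pole at 0, so they are expanded as Laurent series, by the embedding of fields that maps
  \<open>p / q\<close> to the quotient of the Laurent series of \<open>p\<close> and \<open>q\<close>.
\<close>

definition fls_of_ratfun :: "rat poly fract \<Rightarrow> rat fls" where
  "fls_of_ratfun x =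
     (let (p, q) = quot_of_fract x in fps_to_fls (fps_of_poly p) / fps_to_fls (fps_of_poly q))"

lemma fls_of_ratfun_Fract:
  assumes "q \<noteq> 0"
  shows "fls_of_ratfun (Fract p q) = fps_to_fls (fps_of_poly p) / fps_to_fls (fps_of_poly q)"
proof -
  obtain r s where rs: "quot_of_fract (Fract p q) = (r, s)" by (cases "quot_of_fract (Fract p q)")
  have s: "s \<noteq> 0"
    using snd_quot_of_fract_nonzero[of "Fract p q"] by (simp add: rs)
  have "Fract r s = Fract p q"
    using Fract_quot_of_fract[of "Fract p q"] by (simp add: rs)
  hence "r * q = p * s" using assms s by (simp add: eq_fract)
  hence "fps_of_poly r * fps_of_poly q = fps_of_poly p * fps_of_poly s"
    by (simp flip: fps_of_poly_mult)
  hence "fps_to_fls (fps_of_poly r) * fps_to_fls (fps_of_poly q) =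
         fps_to_fls (fps_of_poly p) * fps_to_fls (fps_of_poly s)"
    by (simp flip: fls_times_fps_to_fls)
  thus ?thesis using assms s by (simp add: fls_of_ratfun_def rs frac_eq_eq)
qed

text \<open>
  The sums over partitions are finite sums, and the infinite product and sum converge, so none of
  the definitions above falls back on a default value.
\<close>

lemma finite_partitions: "finite (partitions n)"
proof (rule finite_subset)
  show "partitions n \<subseteq> {p. set p \<subseteq> {..n} \<and> length p \<le> n}"
  proof
    fix p assume p: "p \<in> partitions n"
    have "length q \<le> sum_list q" if "\<forall>x\<in>set q. 0 < x" for q :: "nat list"
      using that by (induction q) auto
    with p show "p \<in> {p. set p \<subseteq> {..n} \<and> length p \<le> n}"
      by (auto simp: partitions_def member_le_sum_list)
  qed
qed (simp add: finite_lists_length_le)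

lemma finite_ferrers: "finite (ferrers p)"
proof -
  have "ferrers p = (SIGMA i:{..<length p}. {..<p ! i})" by (auto simp: ferrers_def)
  thus ?thesis by simp
qed

lemma qpoch_neg_has_prod: "(\<lambda>j. 1 + fps_X ^ Suc j) has_prod qpoch_neg"
proof -
  define f where "f = (\<lambda>j. 1 + fps_X ^ Suc j :: rat fps)"
  define P where "P = Abs_fps (\<lambda>n. fps_nth (\<Prod>j\<le>n. f j) n)"
  have stab: "fps_nth (\<Prod>j\<le>n + k. f j) n = fps_nth (\<Prod>j\<le>n. f j) n" for n k
    by (induction k) (auto simp: f_def algebra_simps fps_X_power_mult_nth simp flip: power_Suc)
  have "(\<lambda>m. \<Prod>j\<le>m. f j) \<longlonglongrightarrow> P"
    unfolding tendsto_fps_iff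
  proof
    fix n
    show "eventually (\<lambda>m. fps_nth (\<Prod>j\<le>m. f j) n = fps_nth P n) sequentially"
      using eventually_ge_at_top[of n]
      by eventually_elim (metis P_def fps_nth_Abs_fps le_add_diff_inverse stab)
  qed
  moreover have "P \<noteq> 0"
  proof -
    have "fps_nth P 0 = 1" by (simp add: P_def f_def)
    thus ?thesis by auto
  qed
  ultimately have "f has_prod P" by (simp add: has_prod_def raw_has_prod_def)
  moreover from this have "prodinf f = P" by (rule has_prod_unique[symmetric])
  ultimately show ?thesis by (simp add: qpoch_neg_def f_def)
qed

lemma lambert_sum_sums: "(\<lambda>k. fps_X ^ Suc k / (1 + fps_X ^ Suc k)) sums lambert_sum"
proof -
  define f where "f = (\<lambda>k. fps_X ^ Suc k / (1 + fps_X ^ Suc k) :: rat fps)"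
  define S where "S = Abs_fps (\<lambda>n. fps_nth (\<Sum>k<n. f k) n)"
  have f: "fps_nth (f k) n = 0" if "n \<le> k" for n k
  proof -
    have "f k = fps_X ^ Suc k * inverse (1 + fps_X ^ Suc k)"
      unfolding f_def by (rule fps_divide_unit) simp
    thus ?thesis using that by (simp add: fps_X_power_mult_nth del: power_Suc)
  qed
  have stab: "fps_nth (\<Sum>k<n + m. f k) n = fps_nth (\<Sum>k<n. f k) n" for n m
    by (induction m) (auto simp: f)
  have "f sums S"
    unfolding sums_def tendsto_fps_iff
  proof
    fix n
    show "eventually (\<lambda>m. fps_nth (\<Sum>k<m. f k) n = fps_nth S n) sequentially"
      using eventually_ge_at_top[of n]
      by eventually_elim (metis S_def fps_nth_Abs_fps le_add_diff_inverse stab)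
  qed
  moreover from this have "suminf f = S" by (rule sums_unique[symmetric])
  ultimately show ?thesis by (simp add: lambert_sum_def f_def)
qed

end

theory Submission
  imports Defs "HOL-Combinatorics.Permutations"
begin

text \<open>
  A box of arm \<open>m\<close> in column \<open>c\<close> lies in a row of length \<open>k = c + m\<close>, and its leg consists of the
  parts in \<open>[c, k)\<close> together with the rows of length \<open>k\<close> below it.  Having hook number \<open>h\<close> is therefore
  a condition on the multiplicities of the parts \<open>c, \<dots>, c + m\<close> with \<open>m < h\<close> only, and for each of the
  finitely many admissible vectors of multiplicities the generating function is \<open>(-q;q)\<^sub>\<infinity>\<close> times a
  sum over \<open>c\<close> of a rational function of \<open>q\<close> and \<open>x = q\<^sup>c\<close>.

  For partitions into odd parts this function is a polynomial in \<open>x\<close> without constant term (on each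
  parity class of \<open>c\<close>), so the sum over \<open>c\<close> is a combination of geometric series.  For distinct
  parts it is \<open>R(x) = \<Prod> x\<^sub>i / (1 + x\<^sub>i)\<close> over the parts present times \<open>\<Prod> 1 / (1 + x\<^sub>i)\<close> over the
  parts absent, with \<open>x\<^sub>i = x q\<^sup>i\<close>.  By partial fractions it is a combination of the
  \<open>x\<^sub>i / (1 + x\<^sub>i)\<close> whose coefficients add up to \<open>R(\<infinity>)\<close>, and each of these sums to the Lambert
  series up to a rational function.  \<open>R(\<infinity>)\<close> is 1 if all parts are present, which happens for
  \<open>h = 2m + 1\<close>, and 0 otherwise.
\<close>

subsection \<open>Rational power series and summable families\<close>

text \<open>The equation has its denominator cleared, which admits polynomials \<open>q\<close> that
  vanish at 0; no unit condition has to be carried through the closure properties.\<close>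

definition rational_fps :: "rat fps \<Rightarrow> bool" where
  "rational_fps f \<longleftrightarrow> (\<exists>p q. q \<noteq> 0 \<and> fps_of_poly q * f = fps_of_poly p)"

lemma rational_fps_of_poly [simp]: "rational_fps (fps_of_poly p)"
  unfolding rational_fps_def by (rule exI[of _ p], rule exI[of _ 1]) simp

lemma rational_fps_0 [simp]: "rational_fps 0" and rational_fps_1 [simp]: "rational_fps 1"
  using rational_fps_of_poly[of 0] rational_fps_of_poly[of 1] by simp_all

lemma rational_fps_X_power [simp]: "rational_fps (fps_X ^ n)"
  using rational_fps_of_poly[of "monom 1 n"] by (simp add: fps_of_poly_monom')

lemma rational_fps_add:
  assumes "rational_fps f" "rational_fps g"
  shows "rational_fps (f + g)"
proof -
  obtain p q r s where "q \<noteq> 0" "s \<noteq> 0" and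
    *: "fps_of_poly q * f = fps_of_poly p" "fps_of_poly s * g = fps_of_poly r"
    using assms unfolding rational_fps_def by blast
  have "fps_of_poly (q * s) * (f + g) =
      fps_of_poly s * (fps_of_poly q * f) + fps_of_poly q * (fps_of_poly s * g)"
    by (simp add: fps_of_poly_mult algebra_simps)
  also have "\<dots> = fps_of_poly (s * p + q * r)"
    by (simp add: * fps_of_poly_mult fps_of_poly_add)
  finally show ?thesis
    unfolding rational_fps_def using \<open>q \<noteq> 0\<close> \<open>s \<noteq> 0\<close> by (metis mult_eq_0_iff)
qed

lemma rational_fps_mult:
  assumes "rational_fps f" "rational_fps g"
  shows "rational_fps (f * g)"
proof -
  obtain p q r s where "q \<noteq> 0" "s \<noteq> 0" and
    *: "fps_of_poly q * f = fps_of_poly p" "fps_of_poly s * g = fps_of_poly r"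
    using assms unfolding rational_fps_def by blast
  have "fps_of_poly (q * s) * (f * g) = (fps_of_poly q * f) * (fps_of_poly s * g)"
    by (simp add: fps_of_poly_mult algebra_simps)
  also have "\<dots> = fps_of_poly (p * r)"
    by (simp add: * fps_of_poly_mult)
  finally show ?thesis
    unfolding rational_fps_def using \<open>q \<noteq> 0\<close> \<open>s \<noteq> 0\<close> by (metis mult_eq_0_iff)
qed

lemma rational_fps_uminus: "rational_fps f \<Longrightarrow> rational_fps (- f)"
  using rational_fps_mult[OF rational_fps_of_poly[of "-1"], of f] by (simp only: fps_of_poly_uminus fps_of_poly_1 mult_minus1)

lemma rational_fps_sum: "(\<And>x. x \<in> A \<Longrightarrow> rational_fps (f x)) \<Longrightarrow> rational_fps (\<Sum>x\<in>A. f x)"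
  by (induction A rule: infinite_finite_induct) (auto intro: rational_fps_add)

text \<open>Division by a polynomial whose constant term may be zero serves for the coefficients
  \<open>fps_X ^ i - fps_X ^ m\<close> that arise from partial fractions.\<close>

lemma rational_fps_cancel:
  assumes "rational_fps (fps_of_poly q * f)" "q \<noteq> 0"
  shows "rational_fps f"
proof -
  obtain p r where "r \<noteq> 0" "fps_of_poly r * (fps_of_poly q * f) = fps_of_poly p"
    using assms(1) unfolding rational_fps_def by blast
  hence "fps_of_poly (r * q) * f = fps_of_poly p"
    by (simp add: fps_of_poly_mult mult.assoc)
  thus ?thesis
    unfolding rational_fps_def using \<open>r \<noteq> 0\<close> \<open>q \<noteq> 0\<close> by (metis mult_eq_0_iff)
qed

lemma rational_fps_imp_fls_of_ratfun:
  assumes "rational_fps f"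
  shows "\<exists>x. fls_of_ratfun x = fps_to_fls f"
proof -
  obtain p q where "q \<noteq> 0" and *: "fps_of_poly q * f = fps_of_poly p"
    using assms unfolding rational_fps_def by blast
  have "fps_to_fls (fps_of_poly p) = fps_to_fls (fps_of_poly q) * fps_to_fls f"
    by (simp add: fls_times_fps_to_fls flip: *)
  with \<open>q \<noteq> 0\<close> have "fls_of_ratfun (Fract p q) = fps_to_fls f"
    by (simp add: fls_of_ratfun_Fract)
  thus ?thesis ..
qed

section \<open>Families whose \<open>c\<close>-th member has order at least \<open>c\<close>, and
  their sums\<close>

definition null_family :: "(nat \<Rightarrow> 'a :: zero fps) \<Rightarrow> bool" where
  "null_family f \<longleftrightarrow> (\<forall>c i. i < c \<longrightarrow> fps_nth (f c) i = 0)"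

text \<open>For a null family the cut-off at \<open>n\<close> omits only zero coefficients, so this
  is the sum over all \<open>c \<ge> 1\<close>. It starts at 1 because \<open>c\<close> will be a
  column counted from 1.\<close>

definition family_sum :: "(nat \<Rightarrow> 'a :: comm_monoid_add fps) \<Rightarrow> 'a fps" where
  "family_sum f = Abs_fps (\<lambda>n. \<Sum>c=1..n. fps_nth (f c) n)"

lemma null_family_mult: "null_family f \<Longrightarrow> null_family (\<lambda>c. g c * (f c :: 'a :: comm_semiring_0 fps))"
  by (auto simp: null_family_def fps_mult_nth)

lemma null_family_add: "null_family f \<Longrightarrow> null_family g \<Longrightarrow> null_family (\<lambda>c. f c + (g c :: 'a :: comm_monoid_add fps))"
  by (auto simp: null_family_def)

lemma null_family_shift: "null_family f \<Longrightarrow> null_family (\<lambda>c. f (c + i))"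
  by (auto simp: null_family_def)

lemma null_family_X_power: "null_family (\<lambda>c. fps_X ^ c :: 'a :: comm_semiring_1 fps)"
  by (auto simp: null_family_def fps_X_power_nth)

lemma family_sum_add:
  "family_sum (\<lambda>c. f c + g c) = family_sum f + (family_sum g :: 'a :: comm_monoid_add fps)"
  by (rule fps_ext) (simp add: family_sum_def sum.distrib)

lemma family_sum_nth_ge:
  assumes "null_family f" "n \<le> N"
  shows "fps_nth (family_sum f) n = (\<Sum>c=1..N. fps_nth (f c) n)"
  using assms by (auto simp: family_sum_def null_family_def intro!: sum.mono_neutral_left)

lemma family_sum_mult:
  fixes g :: "'a :: comm_semiring_0 fps"
  assumes "null_family f"
  shows "family_sum (\<lambda>c. g * f c) = g * family_sum f"
proof (rule fps_ext)
  fix n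
  \<comment> \<open>The inner sums, which by definition end at \<open>n - i\<close>, are extended to
    the common bound \<open>n\<close> so that the order of summation can be exchanged.\<close>
  have "fps_nth (g * family_sum f) n = (\<Sum>i=0..n. fps_nth g i * (\<Sum>c=1..n. fps_nth (f c) (n - i)))"
    by (simp add: fps_mult_nth family_sum_nth_ge[OF assms, of _ n] del: One_nat_def)
  also have "\<dots> = (\<Sum>c=1..n. \<Sum>i=0..n. fps_nth g i * fps_nth (f c) (n - i))"
    by (subst sum.swap) (simp add: sum_distrib_left)
  finally show "fps_nth (family_sum (\<lambda>c. g * f c)) n = fps_nth (g * family_sum f) n"
    by (simp add: family_sum_def fps_mult_nth)
qed

lemma family_sum_shift:
  assumes "null_family f"
  shows "family_sum f = f 1 + family_sum (\<lambda>c. f (c + 1))"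
proof (rule fps_ext)
  fix n
  have "fps_nth (family_sum f) n = (\<Sum>c=1..Suc n. fps_nth (f c) n)"
    by (rule family_sum_nth_ge) (use assms in auto)
  also have "\<dots> = fps_nth (f 1) n + (\<Sum>c=Suc 1..Suc n. fps_nth (f c) n)"
    by (subst sum.atLeast_Suc_atMost) auto
  also have "(\<Sum>c=Suc 1..Suc n. fps_nth (f c) n) = (\<Sum>c=1..n. fps_nth (f (Suc c)) n)"
    by (rule sum.shift_bounds_cl_Suc_ivl)
  finally show "fps_nth (family_sum f) n = fps_nth (f 1 + family_sum (\<lambda>c. f (c + 1))) n"
    by (simp add: family_sum_def)
qed

text \<open>Only the first \<open>i\<close> members are split off. Hence a shifted Lambert series
  differs from the original by a rational function, and a family that reproduces itself up to a
  factor under a shift has a sum determined by a linear equation.\<close>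

lemma family_sum_shift_add:
  assumes "null_family f"
  shows "family_sum f = (\<Sum>j=1..i. f j) + family_sum (\<lambda>c. f (c + i))"
proof (induction i)
  case (Suc i)
  have "family_sum (\<lambda>c. f (c + i)) = f (Suc i) + family_sum (\<lambda>c. f (c + Suc i))"
    using family_sum_shift[OF null_family_shift[OF assms, of i]] by simp
  with Suc show ?case by (simp add: add.assoc)
qed simp

subsection \<open>Hook numbers in terms of multiplicities\<close>

lemma length_filter_eq_sum_count:
  "finite A \<Longrightarrow> length (filter (\<lambda>x. x \<in> A) p) = (\<Sum>j\<in>A. count (mset p) j)"
  proof (induction p)
  case (Cons a p)
  have "(\<Sum>j\<in>A. count (mset (a # p)) j) = (\<Sum>j\<in>A. of_bool (j = a) + count (mset p) j)"
    by (rule sum.cong) auto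
  thus ?case using Cons by (simp add: sum.distrib)
qed simp

text \<open>A new top row moves the old boxes down without changing their hooks, since nothing above
  a box enters its hook. In the new row \<open>k - j\<close> counts the box with its arm, and the
  filter counts its leg.\<close>

lemma hook_numbers_Cons:
  "hook_numbers (k # p) =
     image_mset (\<lambda>j. (k - j) + length (filter (\<lambda>x. j < x) p)) (mset_set {..<k}) + hook_numbers p"
proof -
  define g where "g = (\<lambda>(i::nat, j::nat). (Suc i, j))"
  have inj: "inj_on g A" for A by (auto simp: inj_on_def g_def)
  have f: "ferrers (k # p) = Pair 0 ` {..<k} \<union> g ` ferrers p"
  proof (intro set_eqI iffI)
    fix x assume "x \<in> ferrers (k # p)"
    then obtain i j where x: "x = (i, j)" "i < Suc (length p)" "j < (k # p) ! i"
      by (auto simp: ferrers_def)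
    show "x \<in> Pair 0 ` {..<k} \<union> g ` ferrers p"
    proof (cases i)
      case (Suc i')
      hence "x = g (i', j)" "(i', j) \<in> ferrers p" using x by (auto simp: g_def ferrers_def)
      thus ?thesis by blast
    qed (use x in auto)
  qed (auto simp: g_def ferrers_def)
  have hook_g: "card (hook (k # p) (g x)) = card (hook p x)" for x
  proof -
    have "hook (k # p) (g x) = g ` hook p x"
    proof (intro set_eqI iffI)
      fix y assume y: "y \<in> hook (k # p) (g x)"
      obtain i j where ij: "x = (i, j)" by (cases x)
      obtain i' j' where y': "y = (Suc i', j')"
        using y by (cases y; cases "fst y") (auto simp: hook_def ij g_def)
      hence "(i', j') \<in> hook p x"
        using y by (auto simp: hook_def ij g_def ferrers_def)
      thus "y \<in> g ` hook p x" unfolding y' by (rule rev_image_eqI) (simp add: g_def)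
    qed (cases x, auto simp: hook_def g_def ferrers_def)
    thus ?thesis by (simp add: card_image[OF inj])
  qed
  have hook_0: "card (hook (k # p) (0, j)) = (k - j) + length (filter (\<lambda>x. j < x) p)" if "j < k" for j
  proof -
    define A where "A = {i. i < length p \<and> j < p ! i}"
    have "hook (k # p) (0, j) = Pair 0 ` {j..<k} \<union> (\<lambda>i. (Suc i, j)) ` A"
    proof (intro set_eqI iffI)
      fix y assume y: "y \<in> hook (k # p) (0, j)"
      obtain i' j' where y': "y = (i', j')" by (cases y)
      show "y \<in> Pair 0 ` {j..<k} \<union> (\<lambda>i. (Suc i, j)) ` A"
        using y by (cases i') (auto simp: hook_def y' ferrers_def A_def)
    qed (use that in \<open>auto simp: hook_def A_def ferrers_def\<close>)
    moreover have "card (Pair 0 ` {j..<k} \<union> (\<lambda>i. (Suc i, j)) ` A) = card {j..<k} + card A"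
      by (subst card_Un_disjoint) (auto simp: A_def card_image inj_on_def)
    ultimately show ?thesis by (simp add: A_def length_filter_conv_card)
  qed
  have "mset_set (ferrers (k # p)) = image_mset (Pair 0) (mset_set {..<k}) + image_mset g (mset_set (ferrers p))"
    unfolding f using finite_ferrers[of p] image_mset_mset_set[OF inj, of "ferrers p"]
    by (subst mset_set_Union) (auto simp: image_mset_mset_set[of "Pair 0"] inj_on_def, auto simp: g_def)
  moreover have "image_mset (\<lambda>j. card (hook (k # p) (0, j))) (mset_set {..<k}) =
      image_mset (\<lambda>j. (k - j) + length (filter (\<lambda>x. j < x) p)) (mset_set {..<k})"
    by (rule image_mset_cong) (simp add: hook_0)
  ultimately show ?thesis
    by (simp add: hook_numbers_def image_mset.compositionality comp_def hook_g)
qed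

text \<open>
  Boxes with hook number \<open>h\<close> of a partition with multiplicities \<open>\<mu>\<close>: the column \<open>c\<close> (from 1), the arm
  \<open>m\<close>, and the number \<open>r\<close> of rows of the same length below the box.
\<close>

definition hook_data :: "(nat \<Rightarrow> nat) \<Rightarrow> nat \<Rightarrow> (nat \<times> nat \<times> nat) set" where
  "hook_data \<mu> h =
     {(c, m, r). 1 \<le> c \<and> r < \<mu> (c + m) \<and> m + 1 + (\<Sum>j\<in>{c..<c+m}. \<mu> j) + r = h}"

lemma hook_data_bounds:
  assumes "(c, m, r) \<in> hook_data (count (mset p)) h"
  shows "c + m \<in> set p" "c \<le> sum_list p" "m < h" "r < h"
proof -
  show "c + m \<in> set p"
    using assms by (auto simp: hook_data_def simp flip: count_greater_zero_iff set_mset_mset)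
  hence "c + m \<le> sum_list p" by (rule member_le_sum_list) simp
  thus "c \<le> sum_list p" "m < h" "r < h" using assms by (auto simp: hook_data_def)
qed

lemma finite_hook_data: "finite (hook_data (count (mset p)) h)"
  by (rule finite_subset[of _ "{..sum_list p} \<times> {..<h} \<times> {..<h}"]) (auto dest: hook_data_bounds)

text \<open>Induction puts a longest row \<open>k\<close> on top. Since \<open>c + m \<le> k\<close>
  for every datum, the multiplicities in \<open>{c..<c+m}\<close> stay the same, and only that of
  \<open>k\<close> grows by one; the extra value of \<open>r\<close> accounts for the boxes of the
  new row.\<close>

lemma count_hook_numbers:
  assumes "sorted_wrt (\<ge>) p"
  shows "count (hook_numbers p) h = card (hook_data (count (mset p)) h)"
  using assms
proof (induction p)
  case Nil
  have "hook_data (\<lambda>_. 0) h = {}" by (auto simp: hook_data_def)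
  thus ?case by (simp add: hook_numbers_def ferrers_def)
next
  case (Cons k p)
  hence le: "\<forall>x\<in>set p. x \<le> k" by simp
  define A where "A = {j \<in> {..<k}. (k - j) + length (filter (\<lambda>x. j < x) p) = h}"
  \<comment> \<open>\<open>Suc j\<close> passes to columns counted from 1, and
    \<open>count (mset p) k\<close> rows of the same length lie below the new row.\<close>
  define new where "new = (\<lambda>j. (Suc j, k - Suc j, count (mset p) k)) ` A"
  have leg: "length (filter (\<lambda>x. j < x) p) = (\<Sum>i\<in>{Suc j..<k}. count (mset p) i) + count (mset p) k"
    if "j < k" for j
  proof -
    have "filter (\<lambda>x. j < x) p = filter (\<lambda>x. x \<in> {Suc j..k}) p"
      by (rule filter_cong) (use le in auto)
    hence "length (filter (\<lambda>x. j < x) p) = (\<Sum>i\<in>{Suc j..k}. count (mset p) i)"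
      by (simp only: length_filter_eq_sum_count[OF finite_atLeastAtMost])
    also have "{Suc j..k} = insert k {Suc j..<k}" using that by auto
    finally show ?thesis by simp
  qed
  have big: "count (mset p) x = 0" if "x > k" for x
    using le that by (auto simp: count_eq_zero_iff)
  have "hook_data (count (mset (k # p))) h = new \<union> hook_data (count (mset p)) h"
  proof (intro set_eqI iffI)
    fix x assume x: "x \<in> hook_data (count (mset (k # p))) h"
    obtain c m r where [simp]: "x = (c, m, r)" by (cases x)
    have "c + m \<in> set (k # p)" using x unfolding \<open>x = (c, m, r)\<close> by (rule hook_data_bounds)
    with le have cm: "c + m \<le> k" by auto
    have *: "(\<Sum>j\<in>{c..<c+m}. count (mset (k # p)) j) = (\<Sum>j\<in>{c..<c+m}. count (mset p) j)"
      by (rule sum.cong) (use cm in auto)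
    have hx: "1 \<le> c" "r < count (mset (k # p)) (c + m)"
      "m + 1 + (\<Sum>j\<in>{c..<c+m}. count (mset p) j) + r = h"
      using x unfolding hook_data_def \<open>x = (c, m, r)\<close> mem_Collect_eq case_prod_conv * by blast+
    show "x \<in> new \<union> hook_data (count (mset p)) h"
    \<comment> \<open>A datum belongs to the new row exactly if it refers to the additional copy of
      \<open>k\<close>.\<close>
    proof (cases "c + m = k \<and> r = count (mset p) k")
      case True
      define j where "j = c - 1"
      have j: "c = Suc j" "j < k" "m = k - Suc j" using True hx by (auto simp: j_def)
      have "c + m = k" using True ..
      with hx(3) have "(k - j) + length (filter (\<lambda>x. j < x) p) = h"
        using True j unfolding leg[OF j(2)] by simp
      hence "j \<in> A" using j(2) by (simp add: A_def)
      thus ?thesis using True by (auto simp: new_def j)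
    next
      case False
      thus ?thesis using hx by (auto simp: hook_data_def split: if_splits)
    qed
  next
    fix x assume "x \<in> new \<union> hook_data (count (mset p)) h"
    thus "x \<in> hook_data (count (mset (k # p))) h"
    proof
      assume "x \<in> new"
      then obtain j where j: "j < k" "(k - j) + length (filter (\<lambda>x. j < x) p) = h"
        and [simp]: "x = (Suc j, k - Suc j, count (mset p) k)"
        by (auto simp: new_def A_def)
      have "(\<Sum>i\<in>{Suc j..<Suc j + (k - Suc j)}. count (mset (k # p)) i) =
          (\<Sum>i\<in>{Suc j..<k}. count (mset p) i)"
        by (rule sum.cong) (use j in auto)
      thus ?thesis
        using j(1) j(2)[unfolded leg[OF j(1)]]
        unfolding hook_data_def \<open>x = _\<close> mem_Collect_eq case_prod_conv by simp
    next
      assume x: "x \<in> hook_data (count (mset p)) h"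
      obtain c m r where [simp]: "x = (c, m, r)" by (cases x)
      have "c + m \<in> set p" using x by (auto dest: hook_data_bounds)
      with le have cm: "c + m \<le> k" by auto
      have *: "(\<Sum>j\<in>{c..<c+m}. count (mset (k # p)) j) = (\<Sum>j\<in>{c..<c+m}. count (mset p) j)"
        by (rule sum.cong) (use cm in auto)
      show ?thesis
        using x unfolding hook_data_def \<open>x = _\<close> mem_Collect_eq case_prod_conv * by simp
    qed
  qed
  moreover have "new \<inter> hook_data (count (mset p)) h = {}"
    by (auto simp: new_def A_def hook_data_def)
  moreover have "card new = card A" unfolding new_def by (rule card_image) (auto simp: inj_on_def)
  moreover have "finite new" by (simp add: new_def A_def)
  ultimately have "card (hook_data (count (mset (k # p))) h) = card A + card (hook_data (count (mset p)) h)"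
    by (simp add: card_Un_disjoint finite_hook_data)
  also have "card A = count (image_mset (\<lambda>j. (k - j) + length (filter (\<lambda>x. j < x) p)) (mset_set {..<k})) h"
    by (simp add: A_def count_image_mset_eq_card_vimage)
  finally show ?case using Cons by (simp add: hook_numbers_Cons)
qed

subsection \<open>Generating functions with local weights\<close>

text \<open>For \<open>j \<ge> 1\<close> this is the sum of \<open>w s * fps_X ^ (j * s)\<close>
  over all multiplicities \<open>s\<close> of the part \<open>j\<close>.\<close>

definition part_fps :: "nat \<Rightarrow> (nat \<Rightarrow> rat) \<Rightarrow> rat fps" where
  "part_fps j w = Abs_fps (\<lambda>n. if j dvd n then w (n div j) else 0)"

text \<open>The bound on the parts is separate from the size \<open>n\<close>, so that induction on
  \<open>N\<close> can strip off one part size at a time.\<close>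

definition partition_msets :: "nat \<Rightarrow> nat \<Rightarrow> nat multiset set" where
  "partition_msets N n = {M. set_mset M \<subseteq> {1..N} \<and> sum_mset M = n}"

lemma bij_betw_mset_partitions:
  assumes "n \<le> N"
  shows "bij_betw mset (partitions n) (partition_msets N n)"
proof (rule bij_betwI')
  fix p q assume "p \<in> partitions n" "q \<in> partitions n"
  hence "sorted (rev p)" "sorted (rev q)" by (auto simp: partitions_def sorted_wrt_rev)
  thus "mset p = mset q \<longleftrightarrow> p = q"
    by (metis mset_rev properties_for_sort rev_swap)
next
  fix p assume "p \<in> partitions n"
  thus "mset p \<in> partition_msets N n"
    using assms member_le_sum_list[of _ p]
    by (fastforce simp: partitions_def partition_msets_def sum_mset_sum_list)
next
  fix M assume "M \<in> partition_msets N n"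
  thus "\<exists>p\<in>partitions n. M = mset p"
    by (intro bexI[of _ "rev (sorted_list_of_multiset M)"])
      (auto simp: partitions_def partition_msets_def sorted_wrt_rev simp flip: sum_mset_sum_list)
qed

lemma finite_partition_msets: "finite (partition_msets N n)"
proof (rule finite_subset)
  show "partition_msets N n \<subseteq> partition_msets (max n N) n"
    unfolding partition_msets_def by force
  show "finite (partition_msets (max n N) n)"
    using bij_betw_finite[OF bij_betw_mset_partitions[of n "max n N"]] finite_partitions by simp
qed

text \<open>Deleting the \<open>r\<close> copies of \<open>Suc N\<close> is a bijection that leaves
  the multiplicities of the smaller parts unchanged.\<close>

lemma sum_partition_msets_eq_count:
  fixes w :: "nat \<Rightarrow> nat \<Rightarrow> rat"
  assumes "Suc N * r \<le> n"
  shows "(\<Sum>M | M \<in> partition_msets (Suc N) n \<and> count M (Suc N) = r. \<Prod>j=1..N. w j (count M j)) =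
      (\<Sum>M\<in>partition_msets N (n - Suc N * r). \<Prod>j=1..N. w j (count M j))"
proof (rule sum.reindex_bij_witness[where i = "\<lambda>M. M + replicate_mset r (Suc N)"
        and j = "\<lambda>M. M - replicate_mset r (Suc N)"])
  fix M assume M: "M \<in> {M \<in> partition_msets (Suc N) n. count M (Suc N) = r}"
  have sub: "replicate_mset r (Suc N) \<subseteq># M" using M by (simp flip: count_le_replicate_mset_subset_eq)
  thus "M - replicate_mset r (Suc N) + replicate_mset r (Suc N) = M" by simp
  have "x \<in> {1..N}" if "x \<in># M - replicate_mset r (Suc N)" for x
  proof -
    have "x \<in> {1..Suc N}" using in_diffD[OF that] M by (auto simp: partition_msets_def)
    moreover have "x \<noteq> Suc N" using that M by (auto simp flip: count_greater_zero_iff)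
    ultimately show ?thesis by auto
  qed
  moreover have "sum_mset (M - replicate_mset r (Suc N)) = n - Suc N * r"
    using M by (simp add: sum_mset_diff[OF sub] partition_msets_def algebra_simps)
  ultimately show "M - replicate_mset r (Suc N) \<in> partition_msets N (n - Suc N * r)"
    by (auto simp: partition_msets_def)
  show "(\<Prod>j=1..N. w j (count (M - replicate_mset r (Suc N)) j)) = (\<Prod>j=1..N. w j (count M j))"
    by (rule prod.cong) auto
next
  fix M assume M: "M \<in> partition_msets N (n - Suc N * r)"
  show "M + replicate_mset r (Suc N) - replicate_mset r (Suc N) = M" by simp
  have "Suc N \<notin># M" using M by (auto simp: partition_msets_def)
  hence "count M (Suc N) = 0" by (simp add: count_eq_zero_iff)
  thus "M + replicate_mset r (Suc N) \<in> {M \<in> partition_msets (Suc N) n. count M (Suc N) = r}"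
    using M assms by (auto simp: partition_msets_def split: if_splits)
qed

text \<open>Classifying the multisets by the multiplicity of the largest admissible part yields the
  Cauchy product with the factor of that part.\<close>

lemma prod_part_fps_nth:
  "fps_nth (\<Prod>j=1..N. part_fps j (w j)) n = (\<Sum>M\<in>partition_msets N n. \<Prod>j=1..N. w j (count M j))"
proof (induction N arbitrary: n)
  case 0
  have "partition_msets 0 n = (if n = 0 then {{#}} else {})"
    by (auto simp: partition_msets_def)
  thus ?case by simp
next
  case (Suc N)
  define F where "F r = (\<Sum>M\<in>partition_msets N (n - Suc N * r). \<Prod>j=1..N. w j (count M j))" for r
  let ?P = "\<lambda>r. {M \<in> partition_msets (Suc N) n. count M (Suc N) = r}"
  have *: "count M (Suc N) \<in> {r. Suc N * r \<le> n}" if "M \<in> partition_msets (Suc N) n" for M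
  proof -
    have "replicate_mset (count M (Suc N)) (Suc N) \<subseteq># M" by (simp flip: count_le_replicate_mset_subset_eq)
    then obtain M' where "M = replicate_mset (count M (Suc N)) (Suc N) + M'"
      by (auto simp: mset_subset_eq_exists_conv)
    from arg_cong[OF this, of sum_mset] that show ?thesis
      by (auto simp: partition_msets_def algebra_simps)
  qed
  have fin: "finite {r. Suc N * r \<le> n}"
    by (rule finite_subset[of _ "{..n}"]) (auto intro: le_trans[rotated])
  have "(\<Sum>M\<in>partition_msets (Suc N) n. \<Prod>j=1..Suc N. w j (count M j)) =
      (\<Sum>r | Suc N * r \<le> n. \<Sum>M\<in>?P r. \<Prod>j=1..Suc N. w j (count M j))"
    by (rule sum.group[symmetric]) (use finite_partition_msets fin * in auto)
  also have "\<dots> = (\<Sum>r | Suc N * r \<le> n. w (Suc N) r * F r)"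
  proof (rule sum.cong)
    fix r assume "r \<in> {r. Suc N * r \<le> n}"
    hence "F r = (\<Sum>M\<in>?P r. \<Prod>j=1..N. w j (count M j))"
      unfolding F_def by (intro sum_partition_msets_eq_count[symmetric]) simp
    thus "(\<Sum>M\<in>?P r. \<Prod>j=1..Suc N. w j (count M j)) = w (Suc N) r * F r"
      by (simp add: sum_distrib_left mult.commute)
  qed simp
  also have "\<dots> = (\<Sum>i | i \<le> n \<and> Suc N dvd i. w (Suc N) (i div Suc N) *
      fps_nth (\<Prod>j=1..N. part_fps j (w j)) (n - i))"
    by (rule sum.reindex_bij_witness[where i = "\<lambda>i. i div Suc N" and j = "\<lambda>r. Suc N * r"])
      (auto simp: Suc.IH F_def simp del: mult_Suc One_nat_def)
  also have "\<dots> = (\<Sum>i=0..n. fps_nth (part_fps (Suc N) (w (Suc N))) i *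
      fps_nth (\<Prod>j=1..N. part_fps j (w j)) (n - i))"
    by (rule sum.mono_neutral_cong_left) (auto simp: part_fps_def)
  also have "\<dots> = fps_nth (\<Prod>j=1..Suc N. part_fps j (w j)) n"
    by (simp add: fps_mult_nth mult.commute)
  finally show ?case ..
qed

lemma sum_partitions_eq:
  assumes "n \<le> N"
  shows "(\<Sum>p\<in>partitions n. \<Prod>j=1..N. w j (count (mset p) j)) = fps_nth (\<Prod>j=1..N. part_fps j (w j)) n"
  unfolding prod_part_fps_nth by (rule sum.reindex_bij_betw[OF bij_betw_mset_partitions[OF assms]])

text \<open>The list \<open>xs\<close> stands for the multiplicities of the parts \<open>c, \<dots>, c + m - 1\<close>.\<close>

definition hook_profiles :: "nat \<Rightarrow> (nat \<times> nat list) set" where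
  "hook_profiles h = {(r, xs). length xs + 1 + sum_list xs + r = h}"

lemma finite_hook_profiles: "finite (hook_profiles h)"
proof (rule finite_subset)
  show "hook_profiles h \<subseteq> {..h} \<times> {xs. set xs \<subseteq> {..h} \<and> length xs \<le> h}"
    using member_le_sum_list by (fastforce simp: hook_profiles_def)
qed (simp add: finite_lists_length_le)

section \<open>Hook counts as sums of products of one-part weights\<close>

lemma prod_of_bool:
  "finite A \<Longrightarrow> (\<Prod>j\<in>A. of_bool (P j) :: 'a :: comm_semiring_1) = of_bool (\<forall>j\<in>A. P j)"
  by (induction A rule: finite_induct) auto

text \<open>Recording the whole vector of multiplicities instead of their sum splits the hook
  condition into separate conditions on single multiplicities. The set of profiles is finite and
  depends on \<open>h\<close> only.\<close>

lemma card_hook_data: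
  "(of_nat (card (hook_data (count (mset p)) h)) :: rat) =
     (\<Sum>c=1..sum_list p. \<Sum>(r, xs)\<in>hook_profiles h.
        of_bool (r < count (mset p) (c + length xs) \<and> (\<forall>i<length xs. count (mset p) (c + i) = xs ! i)))"
proof -
  define \<mu> where "\<mu> = count (mset p)"
  define R where "R = (\<lambda>(c, r, xs). r < \<mu> (c + length xs) \<and> (\<forall>i<length xs. \<mu> (c + i) = xs ! i))"
  let ?A = "{1..sum_list p} \<times> hook_profiles h"
  have "bij_betw (\<lambda>(c, m, r). (c, r, map \<mu> [c..<c+m])) (hook_data \<mu> h) {x \<in> ?A. R x}"
  proof (rule bij_betw_byWitness[where f' = "\<lambda>(c, r, xs). (c, length xs, r)"])
    show "(\<lambda>(c, m, r). (c, r, map \<mu> [c..<c+m])) ` hook_data \<mu> h \<subseteq> {x \<in> ?A. R x}"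
    proof safe
      fix c m r assume x: "(c, m, r) \<in> hook_data \<mu> h"
      from hook_data_bounds[OF x[unfolded \<mu>_def]] x
      show "c \<in> {1..sum_list p}" "(r, map \<mu> [c..<c+m]) \<in> hook_profiles h" "R (c, r, map \<mu> [c..<c+m])"
        by (auto simp: hook_data_def hook_profiles_def R_def interv_sum_list_conv_sum_set_nat)
    qed
    show "(\<lambda>(c, r, xs). (c, length xs, r)) ` {x \<in> ?A. R x} \<subseteq> hook_data \<mu> h"
    proof safe
      fix c r xs assume x: "c \<in> {1..sum_list p}" "(r, xs) \<in> hook_profiles h" "R (c, r, xs)"
      have "xs = map \<mu> [c..<c + length xs]"
        by (rule nth_equalityI) (use x in \<open>auto simp: R_def\<close>)
      hence "sum_list xs = sum_list (map \<mu> [c..<c + length xs])" by (rule arg_cong)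
      hence "sum_list xs = (\<Sum>j\<in>{c..<c + length xs}. \<mu> j)"
        by (simp add: interv_sum_list_conv_sum_set_nat)
      thus "(c, length xs, r) \<in> hook_data \<mu> h"
        using x by (auto simp: R_def hook_data_def hook_profiles_def)
    qed
    show "\<forall>x\<in>{x \<in> ?A. R x}. (\<lambda>(c, m, r). (c, r, map \<mu> [c..<c+m])) ((\<lambda>(c, r, xs). (c, length xs, r)) x) = x"
      by (auto simp: R_def intro!: nth_equalityI)
  qed auto
  hence "of_nat (card (hook_data \<mu> h)) = (\<Sum>x\<in>?A. of_bool (R x) :: rat)"
    by (simp add: bij_betw_same_card finite_hook_profiles sum.If_cases of_bool_def Int_def)
  also have "\<dots> = (\<Sum>c=1..sum_list p. \<Sum>y\<in>hook_profiles h. of_bool (R (c, y)))"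
    by (subst sum.cartesian_product) simp
  finally show ?thesis by (simp add: \<mu>_def R_def case_prod_unfold)
qed

text \<open>For a fixed column and profile the conditions form a product of one-part weights, so the
  sum over partitions is a coefficient of a product of series. Parts up to \<open>n + h\<close>
  cover the window of the profile because \<open>c \<le> n\<close> and
  \<open>length xs < h\<close>.\<close>

lemma sum_hook_numbers:
  assumes C: "C = {p \<in> partitions n. \<forall>j\<in>{1..n+h}. allowed j (count (mset p) j)}"
  shows "(of_nat (\<Sum>p\<in>C. count (hook_numbers p) h) :: rat) =
    (\<Sum>c=1..n. \<Sum>(r, xs)\<in>hook_profiles h. fps_nth (\<Prod>j=1..n+h. part_fps j (\<lambda>s. of_bool (allowed j s \<and>
       (c \<le> j \<and> j < c + length xs \<longrightarrow> s = xs ! (j - c)) \<and> (j = c + length xs \<longrightarrow> r < s)))) n)"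
proof -
  let ?W = "\<lambda>c r xs j s. allowed j s \<and>
       (c \<le> j \<and> j < c + length xs \<longrightarrow> s = xs ! (j - c)) \<and> (j = c + length xs \<longrightarrow> r < s)"
  have local: "of_bool (\<forall>j\<in>{1..n+h}. allowed j (\<mu> j)) *
      of_bool (r < \<mu> (c + length xs) \<and> (\<forall>i<length xs. \<mu> (c + i) = xs ! i)) =
      (\<Prod>j=1..n+h. of_bool (?W c r xs j (\<mu> j)) :: rat)"
    if "c \<in> {1..n}" "(r, xs) \<in> hook_profiles h" for \<mu> c r xs
  proof -
    have len: "length xs < h" using that by (auto simp: hook_profiles_def)
    have "(\<forall>j\<in>{1..n+h}. ?W c r xs j (\<mu> j)) \<longleftrightarrow> (\<forall>j\<in>{1..n+h}. allowed j (\<mu> j)) \<and>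
      (r < \<mu> (c + length xs) \<and> (\<forall>i<length xs. \<mu> (c + i) = xs ! i))" (is "?L \<longleftrightarrow> ?R")
    proof
      assume L: ?L
      have "\<mu> (c + i) = xs ! i" if "i < length xs" for i
        using L[rule_format, of "c + i"] that len \<open>c \<in> {1..n}\<close> by auto
      moreover have "r < \<mu> (c + length xs)"
        using L[rule_format, of "c + length xs"] len \<open>c \<in> {1..n}\<close> by auto
      ultimately show ?R using L by blast
    next
      assume R: ?R
      have "\<mu> j = xs ! (j - c)" if "c \<le> j" "j < c + length xs" for j
      proof -
        have "\<mu> (c + (j - c)) = xs ! (j - c)" using R that by (metis less_diff_conv2 add.commute)
        thus ?thesis using that by simp
      qed
      thus ?L using R by blast
    qed
    thus ?thesis
      unfolding prod_of_bool[OF finite_atLeastAtMost] by (simp only: of_bool_conj)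
  qed
  have gf: "(\<Sum>p\<in>partitions n. \<Prod>j=1..n+h. of_bool (?W c r xs j (count (mset p) j))) =
      fps_nth (\<Prod>j=1..n+h. part_fps j (\<lambda>s. of_bool (?W c r xs j s))) n" for c r xs
    by (rule sum_partitions_eq) simp
  have "(of_nat (\<Sum>p\<in>C. count (hook_numbers p) h) :: rat) =
      (\<Sum>p\<in>partitions n. of_bool (\<forall>j\<in>{1..n+h}. allowed j (count (mset p) j)) * of_nat (count (hook_numbers p) h))"
    unfolding C of_nat_sum
    by (rule sum.mono_neutral_cong_left) (auto simp: finite_partitions)
  also have "\<dots> = (\<Sum>p\<in>partitions n. \<Sum>c=1..n. \<Sum>(r, xs)\<in>hook_profiles h.
      \<Prod>j=1..n+h. of_bool (?W c r xs j (count (mset p) j)))"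
  proof (rule sum.cong)
    fix p assume p: "p \<in> partitions n"
    hence "sorted_wrt (\<ge>) p" "sum_list p = n" by (auto simp: partitions_def)
    thus "of_bool (\<forall>j\<in>{1..n+h}. allowed j (count (mset p) j)) * of_nat (count (hook_numbers p) h) =
      (\<Sum>c=1..n. \<Sum>(r, xs)\<in>hook_profiles h. \<Prod>j=1..n+h. of_bool (?W c r xs j (count (mset p) j)) :: rat)"
      unfolding count_hook_numbers[OF \<open>sorted_wrt (\<ge>) p\<close>] card_hook_data sum_distrib_left \<open>sum_list p = n\<close>
      by (intro sum.cong refl) (auto simp only: local split_beta prod.collapse)
  qed simp
  also have "\<dots> = (\<Sum>c=1..n. \<Sum>(r, xs)\<in>hook_profiles h. \<Sum>p\<in>partitions n.
      \<Prod>j=1..n+h. of_bool (?W c r xs j (count (mset p) j)))"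
    by (subst sum.swap, rule sum.cong, simp, subst sum.swap) (simp add: case_prod_unfold)
  finally show ?thesis
    by (simp only: gf)
qed

section \<open>Factoring out the product over all parts\<close>

lemma prod_local_factors:
  fixes G :: "nat \<Rightarrow> 'a :: comm_semiring_1"
  assumes "1 \<le> c" "c + m \<le> N"
  shows "(\<Prod>j=1..N. G j * (if c \<le> j \<and> j < c + m then f (j - c) j else if j = c + m then t j else 1)) =
    (\<Prod>j=1..N. G j) * ((\<Prod>i<m. f i (c + i)) * t (c + m))"
proof -
  let ?L = "\<lambda>j. if c \<le> j \<and> j < c + m then f (j - c) j else if j = c + m then t j else 1"
  have "(\<Prod>j=1..N. ?L j) = (\<Prod>j\<in>{c..<c+Suc m}. ?L j)"
    by (rule prod.mono_neutral_right) (use assms in auto)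
  also have "\<dots> = (\<Prod>i<Suc m. ?L (c + i))"
    by (rule prod.reindex_bij_witness[where i = "\<lambda>i. c + i" and j = "\<lambda>j. j - c"]) auto
  finally show ?thesis by (simp add: prod.distrib)
qed

text \<open>This is the common reduction for both classes of partitions. \<open>G j\<close> is the
  series of all allowed multiplicities of \<open>j\<close>; \<open>f s j\<close> and
  \<open>t r j\<close> are the ratios to it when the multiplicity is \<open>s\<close> or exceeds
  \<open>r\<close>. A profile changes only the factors from \<open>c\<close> to
  \<open>c + length xs\<close>, so \<open>Q\<close> splits off.\<close>

lemma hook_gf:
  fixes G :: "nat \<Rightarrow> rat fps"
  assumes C: "\<And>n N. n \<le> N \<Longrightarrow> C n = {p \<in> partitions n. \<forall>j\<in>{1..N}. allowed j (count (mset p) j)}"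
    and G: "\<And>j. 1 \<le> j \<Longrightarrow> part_fps j (\<lambda>s. of_bool (allowed j s)) = G j"
    and f: "\<And>j s. 1 \<le> j \<Longrightarrow> part_fps j (\<lambda>x. of_bool (allowed j x \<and> x = s)) = G j * f s j"
    and t: "\<And>j r. 1 \<le> j \<Longrightarrow> part_fps j (\<lambda>x. of_bool (allowed j x \<and> r < x)) = G j * t r j"
    and null: "\<And>r. null_family (t r)"
    and Q: "\<And>N i. i \<le> N \<Longrightarrow> fps_nth (\<Prod>j=1..N. G j) i = fps_nth Q i"
  shows "Abs_fps (\<lambda>n. of_nat (\<Sum>p\<in>C n. count (hook_numbers p) h)) =
    Q * (\<Sum>(r, xs)\<in>hook_profiles h.
      family_sum (\<lambda>c. (\<Prod>i<length xs. f (xs ! i) (c + i)) * t r (c + length xs)))"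
proof (rule fps_ext)
  fix n
  define loc where "loc = (\<lambda>r xs c. (\<Prod>i<length xs. f (xs ! i) (c + i)) * t r (c + length xs))"
  \<comment> \<open>The last factor alone has order at least \<open>c\<close>, whatever the other
    factors are.\<close>
  have loc_null: "null_family (loc r xs)" for r xs
    unfolding loc_def by (intro null_family_mult null_family_shift null)
  have *: "(\<Prod>j=1..n+h. part_fps j (\<lambda>s. of_bool (allowed j s \<and>
       (c \<le> j \<and> j < c + length xs \<longrightarrow> s = xs ! (j - c)) \<and> (j = c + length xs \<longrightarrow> r < s)))) =
      (\<Prod>j=1..n+h. G j) * loc r xs c"
    if "c \<in> {1..n}" "(r, xs) \<in> hook_profiles h" for c r xs
  proof -
    have "(\<Prod>j=1..n+h. part_fps j (\<lambda>s. of_bool (allowed j s \<and>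
       (c \<le> j \<and> j < c + length xs \<longrightarrow> s = xs ! (j - c)) \<and> (j = c + length xs \<longrightarrow> r < s)))) =
      (\<Prod>j=1..n+h. G j * (if c \<le> j \<and> j < c + length xs then f (xs ! (j - c)) j
        else if j = c + length xs then t r j else 1))"
    proof (rule prod.cong)
      fix j assume "j \<in> {1..n+h}"
      hence "1 \<le> j" by simp
      consider "c \<le> j \<and> j < c + length xs" | "j = c + length xs" | "\<not> (c \<le> j \<and> j < c + length xs)" "j \<noteq> c + length xs"
        by blast
      thus "part_fps j (\<lambda>s. of_bool (allowed j s \<and>
       (c \<le> j \<and> j < c + length xs \<longrightarrow> s = xs ! (j - c)) \<and> (j = c + length xs \<longrightarrow> r < s))) =
       G j * (if c \<le> j \<and> j < c + length xs then f (xs ! (j - c)) j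
        else if j = c + length xs then t r j else 1)"
      proof cases
        case 1
        thus ?thesis using f[OF \<open>1 \<le> j\<close>, of "xs ! (j - c)"] by simp
      next
        case 2
        thus ?thesis using t[OF \<open>1 \<le> j\<close>, of r] by simp
      next
        case 3
        have e: "(\<lambda>s. of_bool (allowed j s \<and>
       (c \<le> j \<and> j < c + length xs \<longrightarrow> s = xs ! (j - c)) \<and> (j = c + length xs \<longrightarrow> r < s)) :: rat) = (\<lambda>s. of_bool (allowed j s))"
          using 3 by auto
        show ?thesis unfolding e G[OF \<open>1 \<le> j\<close>] using 3 by auto
      qed
    qed simp
    also have "\<dots> = (\<Prod>j=1..n+h. G j) * loc r xs c"
      unfolding loc_def by (rule prod_local_factors) (use that in \<open>auto simp: hook_profiles_def\<close>)
    finally show ?thesis .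
  qed
  define S where "S = (\<Sum>(r, xs)\<in>hook_profiles h. family_sum (loc r xs))"
  \<comment> \<open>One range of \<open>c\<close> serves all coefficients up to order
    \<open>n\<close>, so the sum over \<open>c\<close> can be interchanged with the Cauchy
    product.\<close>
  have S_nth: "fps_nth S i = (\<Sum>c=1..n. \<Sum>(r, xs)\<in>hook_profiles h. fps_nth (loc r xs c) i)" if "i \<le> n" for i
    unfolding S_def fps_sum_nth
    by (subst sum.swap, rule sum.cong) (auto simp: family_sum_nth_ge[OF loc_null that] split: prod.splits)
  have "of_nat (\<Sum>p\<in>C n. count (hook_numbers p) h) =
      (\<Sum>c=1..n. \<Sum>(r, xs)\<in>hook_profiles h. fps_nth ((\<Prod>j=1..n+h. G j) * loc r xs c) n)"
    unfolding sum_hook_numbers[OF C[OF le_add1]] using *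
    by (intro sum.cong refl) (auto simp only: split_beta prod.collapse)
  also have "\<dots> = (\<Sum>c=1..n. \<Sum>(r, xs)\<in>hook_profiles h. \<Sum>i=0..n. fps_nth Q i * fps_nth (loc r xs c) (n - i))"
    by (intro sum.cong refl) (auto simp: fps_mult_nth Q simp del: One_nat_def intro!: sum.cong)
  also have "\<dots> = (\<Sum>c=1..n. \<Sum>i=0..n. \<Sum>(r, xs)\<in>hook_profiles h. fps_nth Q i * fps_nth (loc r xs c) (n - i))"
    by (rule sum.cong, simp, subst sum.swap) (simp add: case_prod_unfold)
  also have "\<dots> = (\<Sum>i=0..n. \<Sum>c=1..n. \<Sum>(r, xs)\<in>hook_profiles h. fps_nth Q i * fps_nth (loc r xs c) (n - i))"
    by (rule sum.swap)
  also have "\<dots> = fps_nth (Q * S) n"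
    by (simp add: fps_mult_nth S_nth sum_distrib_left case_prod_unfold)
  finally show "fps_nth (Abs_fps (\<lambda>n. of_nat (\<Sum>p\<in>C n. count (hook_numbers p) h))) n = fps_nth (Q * (\<Sum>(r, xs)\<in>hook_profiles h.
      family_sum (\<lambda>c. (\<Prod>i<length xs. f (xs ! i) (c + i)) * t r (c + length xs)))) n"
    by (simp add: S_def loc_def)
qed

subsection \<open>Distinct parts\<close>

definition lambert_term :: "nat \<Rightarrow> rat fps" where
  "lambert_term j = fps_X ^ j * inverse (1 + fps_X ^ j)"

lemma lambert_term_unit: "fps_nth (1 + fps_X ^ j :: rat fps) 0 \<noteq> 0"
  by simp

lemma lambert_term_mult: "(1 + fps_X ^ j) * lambert_term j = fps_X ^ j"
proof -
  have "(1 + fps_X ^ j) * lambert_term j = fps_X ^ j * (inverse (1 + fps_X ^ j) * (1 + fps_X ^ j))"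
    unfolding lambert_term_def by (simp only: mult_ac)
  thus ?thesis by (simp only: inverse_mult_eq_1[OF lambert_term_unit] mult_1_right)
qed

lemma null_family_lambert_term: "null_family lambert_term"
  using null_family_mult[OF null_family_X_power, of "\<lambda>c. inverse (1 + fps_X ^ c :: rat fps)"]
  by (simp add: lambert_term_def[abs_def] mult.commute)

lemma rational_lambert_term: "rational_fps (lambert_term j)"
proof (rule rational_fps_cancel)
  show "rational_fps (fps_of_poly (1 + monom 1 j) * lambert_term j)"
    by (simp add: fps_of_poly_add fps_of_poly_monom' lambert_term_mult)
  have "poly (1 + monom 1 j) (1::rat) \<noteq> poly 0 1" by (simp add: poly_monom)
  thus "1 + monom (1::rat) j \<noteq> 0" by metis
qed

lemma lambert_sum_eq: "lambert_sum = family_sum lambert_term"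
proof (rule fps_ext)
  fix n
  have "(\<lambda>k. lambert_term (Suc k)) sums lambert_sum"
    using lambert_sum_sums by (simp add: lambert_term_def fps_divide_unit del: power_Suc)
  hence "eventually (\<lambda>m. fps_nth (\<Sum>k<m. lambert_term (Suc k)) n = fps_nth lambert_sum n) sequentially"
    by (auto simp: sums_def tendsto_fps_iff)
  then obtain M where M: "\<And>m. m \<ge> M \<Longrightarrow> fps_nth (\<Sum>k<m. lambert_term (Suc k)) n = fps_nth lambert_sum n"
    by (auto simp: eventually_sequentially)
  have "fps_nth lambert_sum n = (\<Sum>k<max M n. fps_nth (lambert_term (Suc k)) n)"
    using M[of "max M n"] by (simp add: fps_sum_nth)
  also have "\<dots> = (\<Sum>c=1..max M n. fps_nth (lambert_term c) n)"
    by (simp add: sum.atLeast1_atMost_eq)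
  also have "\<dots> = fps_nth (family_sum lambert_term) n"
    by (rule family_sum_nth_ge[symmetric]) (auto simp: null_family_lambert_term)
  finally show "fps_nth lambert_sum n = fps_nth (family_sum lambert_term) n" .
qed

text \<open>Partial fractions in \<open>x = fps_X ^ c\<close>. The difference
  \<open>fps_X ^ i - fps_X ^ m\<close> stays on the left because it need not be a unit.\<close>

lemma lambert_term_product:
  "(fps_X ^ i - fps_X ^ m) * (lambert_term (c + i) * lambert_term (c + m)) =
     fps_X ^ i * lambert_term (c + m) - fps_X ^ m * lambert_term (c + i)"
proof -
  define x y z where "x = (fps_X ^ c :: rat fps)" and "y = (fps_X ^ i :: rat fps)" and "z = (fps_X ^ m :: rat fps)"
  define a b where "a = lambert_term (c + i)" and "b = lambert_term (c + m)"
  have a: "(1 + x * y) * a = x * y" and b: "(1 + x * z) * b = x * z"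
    using lambert_term_mult[of "c + i"] lambert_term_mult[of "c + m"]
    by (simp_all add: x_def y_def z_def a_def b_def power_add)
  have "1 + x * y \<noteq> 0" "1 + x * z \<noteq> 0"
    using lambert_term_unit[of "c + i"] lambert_term_unit[of "c + m"]
    unfolding x_def y_def z_def power_add by (metis fps_zero_nth)+
  moreover have "((1 + x * y) * (1 + x * z)) * ((y - z) * (a * b)) =
      (y - z) * (((1 + x * y) * a) * ((1 + x * z) * b))" by (simp only: mult_ac)
  moreover have "((1 + x * y) * (1 + x * z)) * (y * b - z * a) =
      y * (1 + x * y) * ((1 + x * z) * b) - z * (1 + x * z) * ((1 + x * y) * a)"
    by (simp add: algebra_simps)
  moreover have "(y - z) * ((x * y) * (x * z)) = y * (1 + x * y) * (x * z) - z * (1 + x * z) * (x * y)"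
    by (simp add: algebra_simps)
  \<comment> \<open>Both sides agree after multiplication by the nonzero series
    \<open>(1 + x * y) * (1 + x * z)\<close>, and there are no zero divisors.\<close>
  ultimately have "(y - z) * (a * b) = y * b - z * a"
    by (metis a b mult_cancel_left mult_eq_0_iff)
  thus ?thesis by (simp add: x_def y_def z_def a_def b_def)
qed

text \<open>
  Combinations of 1 and the first \<open>m\<close> shifts of \<open>lambert_term\<close> with coefficients rational in \<open>q\<close>;
  \<open>a\<close> and \<open>t\<close> are the values at \<open>q\<^sup>c = 0\<close> and \<open>q\<^sup>c = \<infinity>\<close>.
\<close>

inductive lambert_span :: "nat \<Rightarrow> (nat \<Rightarrow> rat fps) \<Rightarrow> rat fps \<Rightarrow> rat fps \<Rightarrow> bool" for m where
  one: "lambert_span m (\<lambda>c. 1) 1 1"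
| lambert: "i < m \<Longrightarrow> lambert_span m (\<lambda>c. lambert_term (c + i)) 0 1"
| add: "lambert_span m f a t \<Longrightarrow> lambert_span m g b s \<Longrightarrow> lambert_span m (\<lambda>c. f c + g c) (a + b) (t + s)"
| scale: "lambert_span m f a t \<Longrightarrow>
    lambert_span m (\<lambda>c. fps_of_poly p * f c) (fps_of_poly p * a) (fps_of_poly p * t)"
| cancel: "lambert_span m (\<lambda>c. fps_of_poly q * f c) (fps_of_poly q * a) (fps_of_poly q * t) \<Longrightarrow>
    q \<noteq> 0 \<Longrightarrow> null_family (\<lambda>c. f c - a) \<Longrightarrow> lambert_span m f a t"

text \<open>Subtracting the limit \<open>a\<close> of \<open>f c\<close> leaves a family that can be
  summed over \<open>c\<close>. For \<open>cancel\<close> this is a premise, since division by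
  \<open>q\<close> may lower the order.\<close>

lemma lambert_span_null: "lambert_span m f a t \<Longrightarrow> null_family (\<lambda>c. f c - a)"
proof (induction rule: lambert_span.induct)
  case (lambert i)
  show ?case using null_family_shift[OF null_family_lambert_term] by simp
next
  case (add f a t g b s)
  from null_family_add[OF add.IH] show ?case by (simp add: algebra_simps)
next
  case (scale f a t p)
  from null_family_mult[OF scale.IH, of "\<lambda>_. fps_of_poly p"] show ?case by (simp add: algebra_simps)
qed (auto simp: null_family_def)

text \<open>A shifted Lambert term has \<open>t - a = 1\<close> and sums to
  \<open>lambert_sum\<close> minus finitely many rational terms, while the constant 1 has
  \<open>t - a = 0\<close> and contributes nothing. The remaining rules respect the claim by
  linearity.\<close>

lemma lambert_span_sum:
  "lambert_span m f a t \<Longrightarrow> rational_fps (family_sum (\<lambda>c. f c - a) - (t - a) * lambert_sum)"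
proof (induction rule: lambert_span.induct)
  case one
  have "family_sum (\<lambda>c. 0 :: rat fps) = 0" by (rule fps_ext) (simp add: family_sum_def)
  thus ?case by simp
next
  case (lambert i)
  have "family_sum (\<lambda>c. lambert_term (c + i)) - lambert_sum = - (\<Sum>j=1..i. lambert_term j)"
    using family_sum_shift_add[OF null_family_lambert_term, of i] by (simp add: lambert_sum_eq)
  thus ?case by (auto intro!: rational_fps_uminus rational_fps_sum rational_lambert_term)
next
  case (add f a t g b s)
  have "family_sum (\<lambda>c. f c + g c - (a + b)) = family_sum (\<lambda>c. f c - a) + family_sum (\<lambda>c. g c - b)"
    by (simp add: algebra_simps flip: family_sum_add)
  with rational_fps_add[OF add.IH] show ?case by (simp add: algebra_simps)
next
  case (scale f a t p)
  have "family_sum (\<lambda>c. fps_of_poly p * f c - fps_of_poly p * a) = fps_of_poly p * family_sum (\<lambda>c. f c - a)"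
    using family_sum_mult[OF lambert_span_null[OF scale.hyps], of "fps_of_poly p"] by (simp add: algebra_simps)
  with rational_fps_mult[OF rational_fps_of_poly[of p] scale.IH] show ?case by (simp add: algebra_simps)
next
  case (cancel q f a t)
  have "family_sum (\<lambda>c. fps_of_poly q * f c - fps_of_poly q * a) = fps_of_poly q * family_sum (\<lambda>c. f c - a)"
    using family_sum_mult[OF cancel.hyps(3), of "fps_of_poly q"] by (simp add: algebra_simps)
  with cancel.IH have "rational_fps (fps_of_poly q * (family_sum (\<lambda>c. f c - a) - (t - a) * lambert_sum))"
    by (simp add: algebra_simps)
  thus ?case using cancel.hyps(2) by (rule rational_fps_cancel)
qed

lemma lambert_span_0: "lambert_span m (\<lambda>c. 0) 0 0"
  using lambert_span.scale[OF lambert_span.one, of m 0] by simp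

lemma lambert_span_diff:
  assumes "lambert_span m f a t" "lambert_span m g b s"
  shows "lambert_span m (\<lambda>c. f c - g c) (a - b) (t - s)"
  using lambert_span.add[OF assms(1) lambert_span.scale[OF assms(2), of "-1"]]
  by (simp add: fps_of_poly_uminus)

lemma lambert_span_mono: "lambert_span m f a t \<Longrightarrow> lambert_span (Suc m) f a t"
  by (induction rule: lambert_span.induct) (auto intro: lambert_span.intros)

text \<open>The new term tends to 0 at \<open>fps_X ^ c = 0\<close> and to 1 at infinity, hence the
  values \<open>0\<close> and \<open>t\<close>. Its index \<open>m\<close> differs from all indices
  \<open>i < m\<close> in the span, so partial fractions meet distinct poles and the denominator
  \<open>monom 1 i - monom 1 m\<close> is nonzero.\<close>

lemma lambert_span_mult:
  "lambert_span m f a t \<Longrightarrow> lambert_span (Suc m) (\<lambda>c. f c * lambert_term (c + m)) 0 t"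
proof (induction rule: lambert_span.induct)
  case one
  show ?case using lambert_span.lambert[of m "Suc m"] by simp
next
  case (lambert i)
  show ?case
  proof (rule lambert_span.cancel)
    have q: "fps_of_poly (monom 1 i - monom 1 m) = (fps_X ^ i - fps_X ^ m :: rat fps)"
      by (simp add: fps_of_poly_diff fps_of_poly_monom')
    have "lambert_span (Suc m) (\<lambda>c. fps_X ^ i * lambert_term (c + m) - fps_X ^ m * lambert_term (c + i))
        (fps_X ^ i * 0 - fps_X ^ m * 0) (fps_X ^ i * 1 - fps_X ^ m * 1)"
      using lambert
        lambert_span_diff[OF lambert_span.scale[OF lambert_span.lambert[of m "Suc m"], of "monom 1 i"]
          lambert_span.scale[OF lambert_span.lambert[of i "Suc m"], of "monom 1 m"]]
      by (simp add: fps_of_poly_monom')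
    thus "lambert_span (Suc m)
        (\<lambda>c. fps_of_poly (monom 1 i - monom 1 m) * (lambert_term (c + i) * lambert_term (c + m)))
        (fps_of_poly (monom 1 i - monom 1 m) * 0) (fps_of_poly (monom 1 i - monom 1 m) * 1)"
      by (simp add: q lambert_term_product)
    have "poly.coeff (monom (1::rat) i - monom 1 m) i = 1" using lambert by simp
    thus "monom (1::rat) i - monom 1 m \<noteq> 0" by (metis coeff_0 zero_neq_one)
    show "null_family (\<lambda>c. lambert_term (c + i) * lambert_term (c + m) - 0)"
      using null_family_mult[OF null_family_shift[OF null_family_lambert_term]] by simp
  qed
next
  case (add f a t g b s)
  from lambert_span.add[OF add.IH] show ?case by (simp add: algebra_simps)
next
  case (scale f a t p)
  from lambert_span.scale[OF scale.IH, of p] show ?case by (simp add: algebra_simps)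
next
  case (cancel q f a t)
  show ?case
  proof (rule lambert_span.cancel)
    show "null_family (\<lambda>c. f c * lambert_term (c + m) - 0)"
      using null_family_mult[OF null_family_shift[OF null_family_lambert_term]] by simp
  qed (use cancel in \<open>simp_all add: mult_ac\<close>)
qed

text \<open>These are the ratios of \<open>fps_X ^ (j * s)\<close> to \<open>1 + fps_X ^ j\<close>;
  an absent part gives \<open>1 / (1 + fps_X ^ j)\<close>, which is
  \<open>1 - lambert_term j\<close>, and a repeated part is forbidden.\<close>

definition distinct_factor :: "nat \<Rightarrow> nat \<Rightarrow> rat fps" where
  "distinct_factor s j = (if s = 0 then 1 - lambert_term j else if s = 1 then lambert_term j else 0)"

text \<open>At infinity a present part has the limit 1 and an absent one the limit 0, seen as
  \<open>t - t\<close> in the induction. The value \<open>a\<close> may stay unspecified because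
  multiplication by one more Lambert term turns it into 0.\<close>

lemma lambert_span_prod:
  "\<exists>a. lambert_span m (\<lambda>c. \<Prod>i<m. distinct_factor (s i) (c + i)) a (of_bool (\<forall>i<m. s i = 1))"
proof (induction m)
  case 0
  show ?case using lambert_span.one[of 0] by auto
next
  case (Suc m)
  then obtain a where a: "lambert_span m (\<lambda>c. \<Prod>i<m. distinct_factor (s i) (c + i)) a (of_bool (\<forall>i<m. s i = 1))" ..
  consider "s m = 0" | "s m = 1" | "s m > 1" by linarith
  thus ?case
  proof cases
    case 1
    with lambert_span_diff[OF lambert_span_mono[OF a] lambert_span_mult[OF a]] show ?thesis
      by (auto simp: distinct_factor_def algebra_simps less_Suc_eq)
  next
    case 2
    hence all: "(\<forall>i<Suc m. s i = 1) \<longleftrightarrow> (\<forall>i<m. s i = 1)" by (auto simp: less_Suc_eq)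
    have "distinct_factor (s m) (c + m) = lambert_term (c + m)" for c
      using 2 by (simp add: distinct_factor_def)
    hence *: "(\<lambda>c. \<Prod>i<Suc m. distinct_factor (s i) (c + i)) =
        (\<lambda>c. (\<Prod>i<m. distinct_factor (s i) (c + i)) * lambert_term (c + m))"
      by (simp only: prod.lessThan_Suc)
    show ?thesis
      unfolding * all using lambert_span_mult[OF a] by (rule exI)
  next
    case 3
    with lambert_span_0[of "Suc m"] show ?thesis
      by (auto simp: distinct_factor_def less_Suc_eq)
  qed
qed

lemma distinct_family_sum:
  "rational_fps (family_sum (\<lambda>c. (\<Prod>i<m. distinct_factor (s i) (c + i)) * lambert_term (c + m))
     - of_bool (\<forall>i<m. s i = 1) * lambert_sum)"
  using lambert_span_prod[of m s] lambert_span_sum[OF lambert_span_mult] by fastforce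

section \<open>Partial products of \<open>qpoch_neg\<close> and the series for distinct
  parts\<close>

lemma qpoch_neg_nth:
  assumes "i \<le> N"
  shows "fps_nth (\<Prod>j=1..N. 1 + fps_X ^ j) i = fps_nth qpoch_neg i"
proof -
  have stab: "fps_nth (\<Prod>j=1..i+k. 1 + fps_X ^ j) i = fps_nth (\<Prod>j=1..i. 1 + fps_X ^ j :: rat fps) i" for k
    by (induction k) (auto simp: algebra_simps fps_X_power_mult_nth simp flip: power_Suc)
  have eq: "(\<Prod>j\<le>m. 1 + fps_X ^ Suc j) = (\<Prod>j=1..Suc m. 1 + fps_X ^ j :: rat fps)" for m
    by (induction m) (simp_all add: mult.commute del: power_Suc)
  have "eventually (\<lambda>m. fps_nth (\<Prod>j\<le>m. 1 + fps_X ^ Suc j) i = fps_nth qpoch_neg i) sequentially"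
    using has_prod_imp_tendsto[OF qpoch_neg_has_prod] by (simp only: tendsto_fps_iff)
  then obtain M where M: "\<And>m. m \<ge> M \<Longrightarrow> fps_nth (\<Prod>j=1..Suc m. 1 + fps_X ^ j) i = fps_nth qpoch_neg i"
    unfolding eq by (auto simp: eventually_sequentially)
  have "fps_nth qpoch_neg i = fps_nth (\<Prod>j=1..i + Suc M. 1 + fps_X ^ j) i"
    using M[of "i + M"] by simp
  also have "\<dots> = fps_nth (\<Prod>j=1..N. 1 + fps_X ^ j) i"
    unfolding stab using stab[of "N - i"] assms by simp
  finally show ?thesis ..
qed

lemma part_fps_eq_0: "part_fps j (\<lambda>s. of_bool False) = 0"
  by (rule fps_ext) (simp add: part_fps_def)

lemma part_fps_single:
  assumes "1 \<le> j"
  shows "part_fps j (\<lambda>x. of_bool (x = s)) = fps_X ^ (j * s)"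
  by (rule fps_ext) (use assms in \<open>auto simp: part_fps_def fps_X_power_nth\<close>)

lemma part_fps_le_1:
  assumes "1 \<le> j"
  shows "part_fps j (\<lambda>x. of_bool (x \<le> 1)) = 1 + fps_X ^ j"
proof -
  have "part_fps j (\<lambda>x. of_bool (x \<le> 1)) =
      part_fps j (\<lambda>x. of_bool (x = 0)) + part_fps j (\<lambda>x. of_bool (x = 1))"
    by (rule fps_ext) (auto simp: part_fps_def of_bool_def)
  thus ?thesis using assms by (simp add: part_fps_single del: One_nat_def)
qed

text \<open>This is \<open>hook_gf\<close> with \<open>G j = 1 + fps_X ^ j\<close>. For a
  multiplicity at most 1, exceeding \<open>r\<close> means \<open>r = 0\<close> and a present part,
  which explains the case distinction.\<close>

lemma b_gf_eq:
  "b_gf h = qpoch_neg * (\<Sum>(r, xs)\<in>hook_profiles h.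
      family_sum (\<lambda>c. (\<Prod>i<length xs. distinct_factor (xs ! i) (c + i)) *
        (if r = 0 then lambert_term (c + length xs) else 0)))"
  unfolding b_gf_def hooks_distinct_def
proof (rule hook_gf[where allowed = "\<lambda>j s. s \<le> 1"])
  fix n N :: nat assume "n \<le> N"
  have "distinct p \<longleftrightarrow> (\<forall>j\<in>{1..N}. count (mset p) j \<le> 1)" if "p \<in> partitions n" for p
  proof -
    have "set p \<subseteq> {1..N}" using that \<open>n \<le> N\<close> member_le_sum_list[of _ p]
      by (fastforce simp: partitions_def)
    hence "(\<forall>j\<in>{1..N}. count (mset p) j \<le> 1) \<longleftrightarrow> (\<forall>j. count (mset p) j \<le> 1)"
      by (metis count_mset_0_iff in_mono zero_le)
    thus ?thesis by (auto simp: distinct_count_atmost_1 le_Suc_eq count_eq_zero_iff)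
  qed
  thus "distinct_partitions n = {p \<in> partitions n. \<forall>j\<in>{1..N}. count (mset p) j \<le> 1}"
    by (auto simp: distinct_partitions_def)
next
  fix j s :: nat assume j: "1 \<le> j"
  show "part_fps j (\<lambda>s. of_bool (s \<le> 1)) = 1 + fps_X ^ j" by (rule part_fps_le_1[OF j])
  have u: "(1 + fps_X ^ j) * (1 - lambert_term j) = 1"
    by (simp only: right_diff_distrib lambert_term_mult) simp
  show "part_fps j (\<lambda>x. of_bool (x \<le> 1 \<and> x = s)) = (1 + fps_X ^ j) * distinct_factor s j"
  proof (cases "s \<le> 1")
    case True
    hence "(\<lambda>x. of_bool (x \<le> 1 \<and> x = s)) = (\<lambda>x. of_bool (x = s) :: rat)" by auto
    hence "part_fps j (\<lambda>x. of_bool (x \<le> 1 \<and> x = s)) = fps_X ^ (j * s)"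
      by (simp only: part_fps_single[OF j])
    moreover from True have "s = 0 \<or> s = 1" by linarith
    ultimately show ?thesis by (auto simp: distinct_factor_def u lambert_term_mult)
  next
    case False
    hence "(\<lambda>x. of_bool (x \<le> 1 \<and> x = s)) = (\<lambda>x. of_bool False :: rat)" by auto
    with False show ?thesis by (simp only: part_fps_eq_0) (simp add: distinct_factor_def)
  qed
  show "part_fps j (\<lambda>x. of_bool (x \<le> 1 \<and> s < x)) = (1 + fps_X ^ j) * (if s = 0 then lambert_term j else 0)"
  proof (cases "s = 0")
    case True
    have "(\<lambda>x. of_bool (x \<le> 1 \<and> s < x)) = (\<lambda>x. of_bool (x = 1) :: rat)" using True by (auto simp: of_bool_def)
    with True show ?thesis by (simp only: part_fps_single[OF j]) (simp add: lambert_term_mult)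
  next
    case False
    hence "(\<lambda>x. of_bool (x \<le> 1 \<and> s < x)) = (\<lambda>x. of_bool False :: rat)" by auto
    with False show ?thesis by (simp only: part_fps_eq_0) simp
  qed
next
  show "null_family (\<lambda>j. if r = 0 then lambert_term j else 0)" for r :: nat
    using null_family_lambert_term by (auto simp: null_family_def)
qed (rule qpoch_neg_nth)

lemma b_gf_rational_part: "\<exists>g. rational_fps g \<and> b_gf h = qpoch_neg * (g + of_bool (odd h) * lambert_sum)"
proof -
  define F where "F = (\<lambda>(r :: nat, xs). family_sum (\<lambda>c. (\<Prod>i<length xs. distinct_factor (xs ! i) (c + i)) *
        (if r = 0 then lambert_term (c + length xs) else 0)))"
  define T where "T = (\<lambda>(r::nat, xs::nat list). r = 0 \<and> (\<forall>i<length xs. xs ! i = 1))"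
  have F: "rational_fps (F x - of_bool (T x) * lambert_sum)" for x :: "nat \<times> nat list"
  proof (cases "fst x = 0")
    case True
    thus ?thesis
      using distinct_family_sum[where m = "length (snd x)" and s = "\<lambda>i. snd x ! i"]
      by (simp add: F_def T_def case_prod_unfold)
  next
    case False
    have "family_sum (\<lambda>c. 0 :: rat fps) = 0" by (rule fps_ext) (simp add: family_sum_def)
    with False show ?thesis by (simp add: F_def T_def case_prod_unfold)
  qed
  have T_iff: "T (r, xs) \<longleftrightarrow> r = 0 \<and> xs = replicate (length xs) 1" for r xs
    by (auto simp: T_def list_eq_iff_nth_eq)
  \<comment> \<open>If \<open>r = 0\<close> and all multiplicities are 1, the hook equation reads
    \<open>2 * length xs + 1 = h\<close>. So exactly one profile carries the Lambert series for odd
    \<open>h\<close>, and none for even \<open>h\<close>.\<close>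
  have "{x \<in> hook_profiles h. T x} = (if odd h then {(0, replicate (h div 2) 1)} else {})"
  proof (intro set_eqI)
    fix x :: "nat \<times> nat list"
    obtain r xs where x: "x = (r, xs)" by (cases x)
    have "x \<in> hook_profiles h \<and> T x \<longleftrightarrow> r = 0 \<and> xs = replicate (length xs) 1 \<and> 2 * length xs + 1 = h"
    proof -
      have "sum_list xs = length xs" if "xs = replicate (length xs) 1"
        by (subst that) (simp add: sum_list_replicate)
      thus ?thesis by (auto simp: x T_iff hook_profiles_def)
    qed
    also have "\<dots> \<longleftrightarrow> odd h \<and> r = 0 \<and> xs = replicate (h div 2) 1"
      by (auto elim!: oddE)
    finally show "x \<in> {x \<in> hook_profiles h. T x} \<longleftrightarrow>
        x \<in> (if odd h then {(0, replicate (h div 2) 1)} else {})"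
      by (simp add: x)
  qed
  hence "(\<Sum>x\<in>hook_profiles h. of_bool (T x)) = (of_bool (odd h) :: rat fps)"
    by (simp add: of_bool_def sum.If_cases finite_hook_profiles Int_def)
  hence "(\<Sum>x\<in>hook_profiles h. F x) =
      (\<Sum>x\<in>hook_profiles h. F x - of_bool (T x) * lambert_sum) + of_bool (odd h) * lambert_sum"
    by (simp add: sum_subtractf sum_distrib_right[symmetric])
  moreover have "b_gf h = qpoch_neg * (\<Sum>x\<in>hook_profiles h. F x)"
    unfolding b_gf_eq F_def ..
  ultimately have "b_gf h = qpoch_neg *
      ((\<Sum>x\<in>hook_profiles h. F x - of_bool (T x) * lambert_sum) + of_bool (odd h) * lambert_sum)"
    by (simp only:)
  moreover have "rational_fps (\<Sum>x\<in>hook_profiles h. F x - of_bool (T x) * lambert_sum)"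
    by (rule rational_fps_sum[OF F])
  ultimately show ?thesis by blast
qed

subsection \<open>Odd parts\<close>

text \<open>On each parity class of \<open>c\<close> these are polynomials in
  \<open>fps_X ^ c\<close> with coefficients polynomial in \<open>fps_X\<close>;
  \<open>1 \<le> d\<close> excludes a constant term, which could not be summed over
  \<open>c\<close>.\<close>

inductive geom_span :: "(nat \<Rightarrow> rat fps) \<Rightarrow> bool" where
  base: "1 \<le> d \<Longrightarrow> geom_span (\<lambda>c. of_bool (even c = b) * fps_X ^ (c * d))"
| add: "geom_span f \<Longrightarrow> geom_span g \<Longrightarrow> geom_span (\<lambda>c. f c + g c)"
| scale: "geom_span f \<Longrightarrow> geom_span (\<lambda>c. fps_of_poly p * f c)"

lemma geom_span_null: "geom_span f \<Longrightarrow> null_family f"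
proof (induction rule: geom_span.induct)
  case (base d b)
  have "i < c * d" if "i < c" for c i using that base by (metis less_le_trans mult_le_mono2 mult_1_right)
  with base show ?case by (auto simp: null_family_def fps_X_power_nth)
qed (auto intro: null_family_add null_family_mult)

lemma geom_span_sum: "geom_span f \<Longrightarrow> rational_fps (family_sum f)"
proof (induction rule: geom_span.induct)
  case (base d b)
  define f where "f = (\<lambda>c. of_bool (even c = b) * fps_X ^ (c * d) :: rat fps)"
  have null: "null_family f" unfolding f_def by (rule geom_span_null[OF geom_span.base[OF base]])
  \<comment> \<open>A shift by 2 preserves parity, so the sum satisfies a linear equation with the
    nonzero coefficient \<open>1 - fps_X ^ (2 * d)\<close>.\<close>
  have "f (c + 2) = fps_X ^ (2 * d) * f c" for c
  proof -
    have "fps_X ^ ((c + 2) * d) = (fps_X ^ (2 * d) * fps_X ^ (c * d) :: rat fps)"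
      unfolding power_add[symmetric] by (simp add: algebra_simps)
    thus ?thesis by (simp only: f_def mult.left_commute) simp
  qed
  hence "family_sum f = (\<Sum>j=1..2. f j) + fps_X ^ (2 * d) * family_sum f"
    using family_sum_shift_add[OF null, of 2] family_sum_mult[OF null, of "fps_X ^ (2 * d)"] by simp
  hence "(1 - fps_X ^ (2 * d)) * family_sum f = (\<Sum>j=1..2. f j)"
    by (simp add: algebra_simps)
  hence "fps_of_poly (1 - monom 1 (2 * d)) * family_sum f = (\<Sum>j=1..2. f j)"
    by (simp add: fps_of_poly_diff fps_of_poly_monom')
  moreover have "rational_fps (\<Sum>j=1..2. f j)"
    by (intro rational_fps_sum) (simp add: f_def of_bool_def)
  moreover have "1 - monom 1 (2 * d) \<noteq> (0 :: rat poly)"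
  proof
    assume "1 - monom 1 (2 * d) = (0 :: rat poly)"
    hence "poly (1 - monom 1 (2 * d)) (0 :: rat) = 0" by simp
    thus False using base by (simp add: poly_monom power_0_left)
  qed
  ultimately show ?case unfolding f_def[symmetric] by (metis rational_fps_cancel)
next
  case (add f g)
  thus ?case by (simp add: family_sum_add rational_fps_add)
next
  case (scale f p)
  thus ?case by (simp add: family_sum_mult[OF geom_span_null] rational_fps_mult)
qed

lemma geom_span_0: "geom_span (\<lambda>c. 0)"
  using geom_span.scale[OF geom_span.base[of 1 True], of 0] by simp

lemma geom_span_shift: "geom_span f \<Longrightarrow> geom_span (\<lambda>c. f c * fps_X ^ ((c + i) * e))"
proof (induction rule: geom_span.induct)
  case (base d b)
  have "geom_span (\<lambda>c. fps_of_poly (monom 1 (i * e)) * (of_bool (even c = b) * fps_X ^ (c * (d + e))))"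
    by (intro geom_span.intros) (use base in simp)
  thus ?case by (simp add: fps_of_poly_monom' add_mult_distrib add_mult_distrib2 power_add mult_ac)
next
  case (add f g)
  from geom_span.add[OF add.IH] show ?case by (simp add: algebra_simps)
next
  case (scale f p)
  from geom_span.scale[OF scale.IH, of p] show ?case by (simp add: algebra_simps)
qed

lemma geom_span_parity: "geom_span f \<Longrightarrow> geom_span (\<lambda>c. f c * of_bool (even c = b))"
proof (induction rule: geom_span.induct)
  case (base d b')
  show ?case
  proof (cases "b = b'")
    case True
    have "(\<lambda>c. of_bool (even c = b') * fps_X ^ (c * d) * of_bool (even c = b)) =
        (\<lambda>c. of_bool (even c = b') * fps_X ^ (c * d) :: rat fps)"
      using True by auto
    with geom_span.base[OF base] show ?thesis by simp
  next
    case False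
    hence "(\<lambda>c. of_bool (even c = b') * fps_X ^ (c * d) * of_bool (even c = b)) =
        (\<lambda>c. 0 :: rat fps)"
      by auto
    with geom_span_0 show ?thesis by simp
  qed
next
  case (add f g)
  from geom_span.add[OF add.IH] show ?case by (simp add: algebra_simps)
next
  case (scale f p)
  from geom_span.scale[OF scale.IH, of p] show ?case by (simp add: algebra_simps)
qed

text \<open>For odd \<open>j\<close> this is the ratio of \<open>fps_X ^ (j * s)\<close> to the
  geometric series \<open>1 / (1 - fps_X ^ j)\<close>; an even \<open>j\<close> may only have
  multiplicity 0.\<close>

definition odd_factor :: "nat \<Rightarrow> nat \<Rightarrow> rat fps" where
  "odd_factor s j = (if odd j then fps_X ^ (j * s) * (1 - fps_X ^ j) else of_bool (s = 0))"

lemma geom_span_odd_factor: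
  assumes "geom_span f"
  shows "geom_span (\<lambda>c. f c * odd_factor s (c + i))"
proof -
  \<comment> \<open>\<open>c + i\<close> is odd exactly if \<open>even c = odd i\<close>. The first
    two summands expand the factor on that class, the third covers the other class.\<close>
  have eq: "f c * odd_factor s (c + i) =
      f c * of_bool (even c = odd i) * fps_X ^ ((c + i) * s) +
      fps_of_poly (-1) * (f c * of_bool (even c = odd i) * fps_X ^ ((c + i) * Suc s)) +
      fps_of_poly (of_bool (s = 0)) * (f c * of_bool (even c = even i))" for c
    by (simp add: odd_factor_def fps_of_poly_uminus power_add algebra_simps)
  show ?thesis
    unfolding eq by (intro geom_span.intros geom_span_shift geom_span_parity assms)
qed

lemma geom_span_prod:
  assumes "geom_span f"
  shows "geom_span (\<lambda>c. f c * (\<Prod>i<m. odd_factor (s i) (c + i)))"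
proof (induction m)
  case (Suc m)
  from geom_span_odd_factor[OF this, of "s m" m] show ?case by (simp add: mult.assoc)
qed (use assms in simp)

text \<open>The last factor contains \<open>fps_X ^ c\<close> to the positive power
  \<open>Suc r\<close> and so starts the span; the other factors are then multiplied on.\<close>

lemma odd_family_sum:
  "rational_fps (family_sum (\<lambda>c. (\<Prod>i<m. odd_factor (s i) (c + i)) *
     (of_bool (odd (c + m)) * fps_X ^ ((c + m) * Suc r))))"
proof -
  have geom: "geom_span (\<lambda>c. fps_of_poly (monom 1 (m * Suc r)) * (of_bool (even c = odd m) * fps_X ^ (c * Suc r)))"
    by (intro geom_span.intros) simp
  have eq: "(\<Prod>i<m. odd_factor (s i) (c + i)) * (of_bool (odd (c + m)) * fps_X ^ ((c + m) * Suc r)) =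
      fps_of_poly (monom 1 (m * Suc r)) * (of_bool (even c = odd m) * fps_X ^ (c * Suc r)) *
      (\<Prod>i<m. odd_factor (s i) (c + i))" for c
  proof -
    have "odd (c + m) \<longleftrightarrow> even c = odd m" by auto
    moreover have "fps_X ^ ((c + m) * Suc r) = (fps_X ^ (m * Suc r) * fps_X ^ (c * Suc r) :: rat fps)"
      unfolding power_add[symmetric] by (simp add: algebra_simps)
    ultimately show ?thesis by (simp only: fps_of_poly_monom' mult_ac)
  qed
  show ?thesis
    unfolding eq by (rule geom_span_sum[OF geom_span_prod[OF geom]])
qed

section \<open>Euler's identity and the series for odd parts\<close>

definition odd_geom :: "nat \<Rightarrow> rat fps" where
  "odd_geom j = (if odd j then inverse (1 - fps_X ^ j) else 1)"

lemma odd_geom_mult: "odd j \<Longrightarrow> odd_geom j * (1 - fps_X ^ j) = 1"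
  unfolding odd_geom_def by (cases j) (auto intro!: inverse_mult_eq_1)

text \<open>Up to order \<open>N\<close> the last product is 1, which gives Euler's identity.\<close>

lemma euler_finite:
  "(\<Prod>j=1..N. 1 + fps_X ^ j) = (\<Prod>j=1..N. odd_geom j) * (\<Prod>j\<in>{N<..2 * N} \<inter> {j. even j}. 1 - fps_X ^ j)"
proof (induction N)
  case (Suc N)
  let ?E = "\<lambda>N. {N<..2 * N} \<inter> {j. even j}"
  \<comment> \<open>From \<open>N\<close> to \<open>Suc N\<close> the range of even exponents gains
    \<open>2 * Suc N\<close> and loses \<open>Suc N\<close> if that is even. The quotient in
    \<open>sq\<close> is accounted for by the lost factor in the even case and by
    \<open>odd_geom (Suc N)\<close> in the odd case.\<close>
  have step: "odd_geom (Suc N) * (\<Prod>j\<in>?E (Suc N). 1 - fps_X ^ j) =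
      (1 + fps_X ^ Suc N) * (\<Prod>j\<in>?E N. 1 - fps_X ^ j :: rat fps)"
  proof -
    have sq: "1 - fps_X ^ (2 * Suc N) = (1 - fps_X ^ Suc N) * (1 + fps_X ^ Suc N :: rat fps)"
      by (simp only: mult_2 power_add) (simp only: algebra_simps, simp)
    show ?thesis
    proof (cases "even (Suc N)")
      case True
      have "insert (Suc N) (?E (Suc N)) = insert (2 * Suc N) (?E N)"
        using True by (auto simp: le_Suc_eq Suc_le_eq odd_pos)
      hence "(\<Prod>j\<in>insert (Suc N) (?E (Suc N)). 1 - fps_X ^ j :: rat fps) = (\<Prod>j\<in>insert (2 * Suc N) (?E N). 1 - fps_X ^ j)"
        by (rule arg_cong[where f = "prod (\<lambda>j. 1 - fps_X ^ j)"])
      moreover have "(\<Prod>j\<in>insert (Suc N) (?E (Suc N)). 1 - fps_X ^ j :: rat fps) =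
          (1 - fps_X ^ Suc N) * (\<Prod>j\<in>?E (Suc N). 1 - fps_X ^ j)"
        by (rule prod.insert) auto
      moreover have "(\<Prod>j\<in>insert (2 * Suc N) (?E N). 1 - fps_X ^ j :: rat fps) =
          (1 - fps_X ^ (2 * Suc N)) * (\<Prod>j\<in>?E N. 1 - fps_X ^ j)"
        by (rule prod.insert) auto
      ultimately have "(1 - fps_X ^ Suc N) * (\<Prod>j\<in>?E (Suc N). 1 - fps_X ^ j) =
          (1 - fps_X ^ (2 * Suc N)) * (\<Prod>j\<in>?E N. 1 - fps_X ^ j :: rat fps)"
        by (rule box_equals)
      hence "(1 - fps_X ^ Suc N) * (\<Prod>j\<in>?E (Suc N). 1 - fps_X ^ j) =
          (1 - fps_X ^ Suc N) * ((1 + fps_X ^ Suc N) * (\<Prod>j\<in>?E N. 1 - fps_X ^ j :: rat fps))"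
        by (simp only: sq mult.assoc)
      moreover have "fps_nth (1 - fps_X ^ Suc N :: rat fps) 0 \<noteq> 0" by simp
      hence "1 - fps_X ^ Suc N \<noteq> (0 :: rat fps)" by (metis fps_zero_nth)
      ultimately have "(\<Prod>j\<in>?E (Suc N). 1 - fps_X ^ j) =
          (1 + fps_X ^ Suc N) * (\<Prod>j\<in>?E N. 1 - fps_X ^ j :: rat fps)"
        by (metis mult_left_cancel)
      moreover have "odd_geom (Suc N) = 1" using True unfolding odd_geom_def by (simp only: not_True_eq_False if_False)
      ultimately show ?thesis by (simp only: mult_1_left)
    next
      case False
      have "?E (Suc N) = insert (2 * Suc N) (?E N)"
        using False by (auto simp: le_Suc_eq intro!: Suc_lessI)
      hence "(\<Prod>j\<in>?E (Suc N). 1 - fps_X ^ j) = (\<Prod>j\<in>insert (2 * Suc N) (?E N). 1 - fps_X ^ j :: rat fps)"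
        by (rule arg_cong[where f = "prod (\<lambda>j. 1 - fps_X ^ j)"])
      also have "\<dots> = (1 - fps_X ^ (2 * Suc N)) * (\<Prod>j\<in>?E N. 1 - fps_X ^ j :: rat fps)"
        by (rule prod.insert) auto
      finally have "(\<Prod>j\<in>?E (Suc N). 1 - fps_X ^ j) = (1 - fps_X ^ (2 * Suc N)) * (\<Prod>j\<in>?E N. 1 - fps_X ^ j :: rat fps)" .
      thus ?thesis unfolding sq by (simp only: mult.assoc[symmetric] odd_geom_mult[OF False] mult_1_left)
    qed
  qed
  have "(\<Prod>j=1..Suc N. 1 + fps_X ^ j) =
      (\<Prod>j=1..N. odd_geom j) * ((1 + fps_X ^ Suc N) * (\<Prod>j\<in>?E N. 1 - fps_X ^ j))"
    by (simp add: Suc.IH mult_ac del: power_Suc One_nat_def)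
  also have "\<dots> = (\<Prod>j=1..Suc N. odd_geom j) * (\<Prod>j\<in>?E (Suc N). 1 - fps_X ^ j)"
    unfolding step[symmetric] by (simp add: mult.assoc del: power_Suc One_nat_def mult_Suc_right)
  finally show ?case .
qed simp

lemma prod_odd_geom_nth:
  assumes "i \<le> N"
  shows "fps_nth (\<Prod>j=1..N. odd_geom j) i = fps_nth qpoch_neg i"
proof -
  have one: "fps_nth (\<Prod>j\<in>A. 1 - fps_X ^ j) n = fps_nth (1 :: rat fps) n" if "finite A" "\<And>j. j \<in> A \<Longrightarrow> n < j" for A n
    using that
    by (induction A rule: finite_induct) (auto simp: left_diff_distrib fps_X_power_mult_nth)
  have "fps_nth qpoch_neg i = fps_nth (\<Prod>j=1..N. 1 + fps_X ^ j) i"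
    using qpoch_neg_nth[OF assms] ..
  also have "\<dots> = (\<Sum>k=0..i. fps_nth (\<Prod>j=1..N. odd_geom j) k * fps_nth (1 :: rat fps) (i - k))"
    unfolding euler_finite fps_mult_nth by (intro sum.cong refl arg_cong2[of _ _ _ _ "(*)"] one) (use assms in auto)
  also have "\<dots> = fps_nth ((\<Prod>j=1..N. odd_geom j) * 1) i"
    unfolding fps_mult_nth ..
  finally show ?thesis by simp
qed

text \<open>The left factor is a tail of the geometric series in \<open>fps_X ^ j\<close>;
  multiplication by \<open>1 - fps_X ^ j\<close> telescopes it to its first term.\<close>

lemma part_fps_greater:
  assumes "1 \<le> j"
  shows "part_fps j (\<lambda>x. of_bool (r < x)) * (1 - fps_X ^ j) = fps_X ^ (j * Suc r)"
proof (rule fps_ext)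
  fix n
  have "fps_nth (part_fps j (\<lambda>x. of_bool (r < x)) * (1 - fps_X ^ j)) n =
     fps_nth (part_fps j (\<lambda>x. of_bool (r < x))) n -
     (if n < j then 0 else fps_nth (part_fps j (\<lambda>x. of_bool (r < x))) (n - j))"
    by (simp add: right_diff_distrib fps_X_power_mult_right_nth)
  also have "\<dots> = fps_nth (fps_X ^ (j * Suc r)) n"
  proof (cases "j dvd n")
    case True
    then obtain k where "n = j * k" ..
    thus ?thesis using assms
      by (cases k) (auto simp: part_fps_def fps_X_power_nth simp del: mult_Suc_right, auto)
  next
    case False
    hence "\<not> j dvd n - j" if "j \<le> n" using that by (simp add: dvd_minus_self)
    thus ?thesis using False by (auto simp: part_fps_def fps_X_power_nth simp del: mult_Suc_right)
  qed
  finally show "fps_nth (part_fps j (\<lambda>x. of_bool (r < x)) * (1 - fps_X ^ j)) n = fps_nth (fps_X ^ (j * Suc r)) n" .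
qed

lemma part_fps_UNIV: "part_fps j (\<lambda>x. 1) = 1 + part_fps j (\<lambda>x. of_bool (0 < x))" if "1 \<le> j"
  by (rule fps_ext) (use that in \<open>auto simp: part_fps_def\<close>)

lemma a_gf_eq:
  "a_gf h = qpoch_neg * (\<Sum>(r, xs)\<in>hook_profiles h.
      family_sum (\<lambda>c. (\<Prod>i<length xs. odd_factor (xs ! i) (c + i)) *
        (of_bool (odd (c + length xs)) * fps_X ^ ((c + length xs) * Suc r))))"
  unfolding a_gf_def hooks_odd_def
proof (rule hook_gf[where allowed = "\<lambda>j s. odd j \<or> s = 0"])
  fix n N :: nat assume "n \<le> N"
  have "(\<forall>x\<in>set p. odd x) \<longleftrightarrow> (\<forall>j\<in>{1..N}. odd j \<or> count (mset p) j = 0)" if "p \<in> partitions n" for p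
  proof -
    have "set p \<subseteq> {1..N}" using that \<open>n \<le> N\<close> member_le_sum_list[of _ p]
      by (fastforce simp: partitions_def)
    thus ?thesis by (auto simp: count_eq_zero_iff)
  qed
  thus "odd_partitions n = {p \<in> partitions n. \<forall>j\<in>{1..N}. odd j \<or> count (mset p) j = 0}"
    by (auto simp: odd_partitions_def)
next
  fix j s :: nat assume j: "1 \<le> j"
  have z: "part_fps j (\<lambda>x. of_bool (x = 0)) = 1" using part_fps_single[OF j, of 0] by simp
  \<comment> \<open>For odd \<open>j\<close> the factor \<open>odd_geom j\<close> is inverse to
    \<open>1 - fps_X ^ j\<close>, so each required identity can be checked after multiplication by
    the latter.\<close>
  have cancel: "f = odd_geom j * g" if "odd j" "f * (1 - fps_X ^ j) = g" for f g
    using odd_geom_mult[OF that(1)] that(2) by (metis mult.left_commute mult.right_neutral)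
  show "part_fps j (\<lambda>s. of_bool (odd j \<or> s = 0)) = odd_geom j"
  proof (cases "odd j")
    case True
    have "part_fps j (\<lambda>s. 1) = odd_geom j * 1"
      by (rule cancel[OF True]) (simp add: part_fps_UNIV[OF j] distrib_right part_fps_greater[OF j])
    with True show ?thesis by simp
  qed (simp add: z odd_geom_def)
  show "part_fps j (\<lambda>x. of_bool ((odd j \<or> x = 0) \<and> x = s)) = odd_geom j * odd_factor s j"
  proof (cases "odd j")
    case True
    have "part_fps j (\<lambda>x. of_bool (x = s)) = odd_geom j * (fps_X ^ (j * s) * (1 - fps_X ^ j))"
      by (rule cancel[OF True]) (simp add: part_fps_single[OF j])
    with True show ?thesis by (simp add: odd_factor_def)
  next
    case False
    have "(\<lambda>x. of_bool ((odd j \<or> x = 0) \<and> x = s)) = (\<lambda>x. of_bool (x = 0 \<and> s = 0) :: rat)"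
      using False by auto
    with False show ?thesis
      by (cases "s = 0") (simp_all add: odd_factor_def odd_geom_def z part_fps_eq_0[simplified])
  qed
  show "part_fps j (\<lambda>x. of_bool ((odd j \<or> x = 0) \<and> s < x)) = odd_geom j * (of_bool (odd j) * fps_X ^ (j * Suc s))"
  proof (cases "odd j")
    case True
    thus ?thesis using cancel[OF True part_fps_greater[OF j]] by simp
  next
    case False
    hence "(\<lambda>x. of_bool ((odd j \<or> x = 0) \<and> s < x)) = (\<lambda>x. of_bool False :: rat)" by auto
    with False show ?thesis by (simp only: part_fps_eq_0) simp
  qed
next
  show "null_family (\<lambda>j. of_bool (odd j) * fps_X ^ (j * Suc r) :: rat fps)" for r :: nat
    using geom_span_null[OF geom_span.base[of "Suc r" False]] by simp
qed (rule prod_odd_geom_nth)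

section \<open>Choice of the rational functions for all \<open>h\<close>\<close>

theorem theorem2p2:
  shows "\<exists>A B :: nat \<Rightarrow> rat poly fract.
    (\<forall>h\<ge>1. fps_to_fls (a_gf h) = fps_to_fls qpoch_neg * fls_of_ratfun (A h)) \<and>
    (\<forall>h\<ge>1. fps_to_fls (b_gf (2 * h)) = fps_to_fls qpoch_neg * fls_of_ratfun (B (2 * h))) \<and>
    (\<forall>h\<ge>0. fps_to_fls (b_gf (2 * h + 1)) =
       fps_to_fls qpoch_neg * (fls_of_ratfun (B (2 * h + 1)) + fps_to_fls lambert_sum))"
proof -
  have "\<exists>x. fps_to_fls (a_gf h) = fps_to_fls qpoch_neg * fls_of_ratfun x" for h
  proof -
    have "rational_fps (\<Sum>(r, xs)\<in>hook_profiles h.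
      family_sum (\<lambda>c. (\<Prod>i<length xs. odd_factor (xs ! i) (c + i)) *
        (of_bool (odd (c + length xs)) * fps_X ^ ((c + length xs) * Suc r))))"
      unfolding case_prod_unfold by (intro rational_fps_sum odd_family_sum)
    from rational_fps_imp_fls_of_ratfun[OF this] show ?thesis
      unfolding a_gf_eq fls_times_fps_to_fls by metis
  qed
  then obtain A where A: "\<And>h. fps_to_fls (a_gf h) = fps_to_fls qpoch_neg * fls_of_ratfun (A h)"
    by metis
  \<comment> \<open>A single function \<open>B\<close> serves both parities, with
    \<open>of_bool (odd h)\<close> switching the Lambert series on at \<open>2 * h + 1\<close> and
    off at \<open>2 * h\<close>.\<close>
  have "\<exists>x. fps_to_fls (b_gf h) =
      fps_to_fls qpoch_neg * (fls_of_ratfun x + fps_to_fls (of_bool (odd h) * lambert_sum))" for h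
  proof -
    obtain g where "rational_fps g" and g: "b_gf h = qpoch_neg * (g + of_bool (odd h) * lambert_sum)"
      using b_gf_rational_part by blast
    then obtain x where "fls_of_ratfun x = fps_to_fls g"
      using rational_fps_imp_fls_of_ratfun by blast
    thus ?thesis
      unfolding g fls_times_fps_to_fls fps_to_fls_plus by metis
  qed
  then obtain B where B: "\<And>h. fps_to_fls (b_gf h) =
      fps_to_fls qpoch_neg * (fls_of_ratfun (B h) + fps_to_fls (of_bool (odd h) * lambert_sum))"
    by metis
  show ?thesis
    by (rule exI[of _ A], rule exI[of _ B]) (simp add: A B)
qed

end
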